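(* The forgetful functor from $\mathbf{uCBCov}_i$ (inductively generated unital convergent covers) to $\mathbf{BCov}_{\circ,i}$ (inductively generated $\circ$-basic covers) has a right adjoint $Q:\mathbf{BCov}_{\circ,i}\to\mathbf{uCBCov}_i$ that is surjective on objects.
   Context: A basic cover $(S,\lhd)$ on a set $S$ is a relation $\lhd$ between elements and subsets of $S$ such that $a\in U$ implies $a\lhd U$, and $a\lhd U$, $U\lhd V$ imply $a\lhd V$, where $U\lhd V$ means $b\lhd V$ for all $b\in U$. Put $\mathcal A U=\{a\in S\mid a\lhd U\}$; $U=_{\mathcal A}V$ means $\mathcal A U=\mathcal A V$. $Sat(\mathcal A)=\{U\subseteq S\mid U=\mathcal A U\}$ has joins $\bigvee^{\mathcal A}_i\mathcal A U_i=\mathcal A(\bigcup_iU_i)$. Elements are identified with singletons; $a\circ b=\{a\}\circ\{b\}$, etc. For a relation $r$ between $S$ and $T$ and $V\subseteq T$, $r^-V=\{a\in S\mid\exists b\in V,\ a\,r\,b\}$. A basic cover map $r:(S,\lhd_S)\to(T,\lhd_T)$ is a relation between $S$ and $T$ such that $b\lhd_TV$ implies $r^-b\lhd_Sr^-V$; two are equal if $r_1^-b=_{\mathcal A_S}r_2^-b$ for all $b\in T$; composition is relational composition. An axiom-set $(I,C)$ on $S$: sets $I(a)$ ($a\in S$) and subsets $C(a,i)\subseteq S$ ($i\in I(a)$). It generates the least basic cover with $a\lhd C(a,i)$ for all $a,i$ (inductively defined by: $a\in U$ implies $a\lhd U$; $i\in I(a)$ and $C(a,i)\lhd U$ imply $a\lhd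 U$). A basic cover is inductively generated if it is generated by some axiom-set. A $\circ$-basic cover $(S,\lhd,\circ)$ is a basic cover with a binary operation $\circ$ on $\mathcal P(S)$ which, modulo $=_{\mathcal A}$, distributes over unions ($\bigcup_i(U_i\circ V)=_{\mathcal A}(\bigcup_iU_i)\circ V$), is associative ($(U\circ V)\circ W=_{\mathcal A}U\circ(V\circ W)$), commutative ($U\circ V=_{\mathcal A}V\circ U$) and has a unit, i.e. a subset $I_S\subseteq S$ with $a=_{\mathcal A}a\circ I_S$ for all $a\in S$. ($\circ$ is not required to respect $=_{\mathcal A}$.) A $\circ$-basic cover map $\mathcal S\to\mathcal T$ is a basic cover map $r$ with $r^-(U\circ_TV)=_{\mathcal A_S}(r^-U)\circ_S(r^-V)$ for all $U,V\subseteq T$ and $r^-I_T=_{\mathcal A_S}I_S$. $\mathbf{BCov}_{\circ,i}$ is the category of $\circ$-basic covers whose underlying basic cover is inductively generated, with $\circ$-basic cover maps. A convergent cover is $(S,\lhd,\circ)$ where $\lhd$ is a basic cover on $S$ and $\circ$ is a binary operation on $\mathcal P(S)$ such that: $U_1\lhd V_1$ and $U_2\lhd V_2$ imply $U_1\circ U_2\lhd V_1\circ V_2$; $(U\circ V)\circ W\lhd U\circ(V\circ W)$; $U\circ V\lhd V\circ U$; and the operation $\mathcal A U\circ^{\mathcal A}\mathcal A V=\mathcal A(U\circ V)$ on $Sat(\mathcal A)$ distributes over arbitrary joins. It is unital if there is $I_S\subseteq S$ with $a\circ I_S=_{\mathcal A}a=_{\mathcal A}I_S\circ a$ for all $a\in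 S$. A unital convergent cover map is a basic cover map $r:\mathcal S\to\mathcal T$ with $r^-(b_1\circ_Tb_2)=_{\mathcal A_S}(r^-b_1)\circ_S(r^-b_2)$ for all $b_1,b_2\in T$ and $r^-I_T=_{\mathcal A_S}I_S$. A convergent cover is inductively generated if it arises from some axiom-set $(I,C)$ on $S$ and map $\delta:S\times S\to\mathcal P(S)$ as follows: $U\circ V=\bigcup\{\delta(a,b)\mid a\in U,b\in V\}$, and $\lhd$ is generated by the axiom-set $(J',D')$, where $(J,D)$ is $(I,C)$ plus the axioms $a\lhd c\circ b$ for $a\in b\circ c$ and $a\lhd b\circ(c\circ d)$ for $a\in(b\circ c)\circ d$, and $(J',D')$ is $(J,D)$ plus the axioms $a\lhd D(b,j)\circ c$ for $a\in b\circ c$, $j\in J(b)$. $\mathbf{uCBCov}_i$ is the category of inductively generated convergent covers that are unital, with unital convergent cover maps. In all these categories equality of morphisms is equality of basic cover maps. *)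

theory Defs
  imports Main "HOL-Library.FuncSet"
begin

section \<open>Categories, functors, adjunctions\<close>

text \<open>Hom-sets are indexed by their end points and need not be disjoint, so composition and the
  action of a functor on arrows receive the end points as arguments.\<close>

record ('o, 'm) cat =
  obj :: "'o set"
  hom :: "'o \<Rightarrow> 'o \<Rightarrow> 'm set"
  cat_comp :: "'o \<Rightarrow> 'o \<Rightarrow> 'o \<Rightarrow> 'm \<Rightarrow> 'm \<Rightarrow> 'm"  \<comment> \<open>\<open>cat_comp C X Y Z g f\<close> is \<open>g\<close> after \<open>f\<close>, for \<open>f : X \<rightarrow> Y\<close>, \<open>g : Y \<rightarrow> Z\<close>\<close>
  ident :: "'o \<Rightarrow> 'm"

definition is_category :: "('o, 'm) cat \<Rightarrow> bool" where
  "is_category C \<longleftrightarrow>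
    (\<forall>X\<in>obj C. ident C X \<in> hom C X X) \<and>
    (\<forall>X\<in>obj C. \<forall>Y\<in>obj C. \<forall>Z\<in>obj C. \<forall>f\<in>hom C X Y. \<forall>g\<in>hom C Y Z.
       cat_comp C X Y Z g f \<in> hom C X Z) \<and>
    (\<forall>X\<in>obj C. \<forall>Y\<in>obj C. \<forall>f\<in>hom C X Y.
       cat_comp C X X Y f (ident C X) = f \<and> cat_comp C X Y Y (ident C Y) f = f) \<and>
    (\<forall>W\<in>obj C. \<forall>X\<in>obj C. \<forall>Y\<in>obj C. \<forall>Z\<in>obj C.
       \<forall>f\<in>hom C W X. \<forall>g\<in>hom C X Y. \<forall>h\<in>hom C Y Z.
         cat_comp C W X Z (cat_comp C X Y Z h g) f = cat_comp C W Y Z h (cat_comp C W X Y g f))"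

record ('o1, 'm1, 'o2, 'm2) func =
  fobj :: "'o1 \<Rightarrow> 'o2"
  fmap :: "'o1 \<Rightarrow> 'o1 \<Rightarrow> 'm1 \<Rightarrow> 'm2"

definition is_functor ::
    "('o1, 'm1) cat \<Rightarrow> ('o2, 'm2) cat \<Rightarrow> ('o1, 'm1, 'o2, 'm2) func \<Rightarrow> bool" where
  "is_functor C D F \<longleftrightarrow> is_category C \<and> is_category D \<and>
    (\<forall>X\<in>obj C. fobj F X \<in> obj D) \<and>
    (\<forall>X\<in>obj C. \<forall>Y\<in>obj C. \<forall>f\<in>hom C X Y. fmap F X Y f \<in> hom D (fobj F X) (fobj F Y)) \<and>
    (\<forall>X\<in>obj C. fmap F X X (ident C X) = ident D (fobj F X)) \<and>
    (\<forall>X\<in>obj C. \<forall>Y\<in>obj C. \<forall>Z\<in>obj C. \<forall>f\<in>hom C X Y. \<forall>g\<in>hom C Y Z.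
       fmap F X Z (cat_comp C X Y Z g f) =
         cat_comp D (fobj F X) (fobj F Y) (fobj F Z) (fmap F Y Z g) (fmap F X Y f))"

definition is_right_adjoint ::
    "('o1, 'm1) cat \<Rightarrow> ('o2, 'm2) cat \<Rightarrow> ('o1, 'm1, 'o2, 'm2) func \<Rightarrow>
     ('o2, 'm2, 'o1, 'm1) func \<Rightarrow> bool" where
  "is_right_adjoint C D F G \<longleftrightarrow> is_functor C D F \<and> is_functor D C G \<and>
    (\<exists>\<phi>.
      (\<forall>X\<in>obj C. \<forall>Y\<in>obj D.
         bij_betw (\<phi> X Y) (hom D (fobj F X) Y) (hom C X (fobj G Y))) \<and>
      (\<forall>X\<in>obj C. \<forall>X'\<in>obj C. \<forall>Y\<in>obj D. \<forall>Y'\<in>obj D.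
       \<forall>h\<in>hom C X' X. \<forall>k\<in>hom D Y Y'. \<forall>f\<in>hom D (fobj F X) Y.
         \<phi> X' Y' (cat_comp D (fobj F X') Y Y' k (cat_comp D (fobj F X') (fobj F X) Y f (fmap F X' X h))) =
         cat_comp C X' (fobj G Y) (fobj G Y') (fmap G Y Y' k)
           (cat_comp C X' X (fobj G Y) (\<phi> X Y f) h)))"

definition surj_on_objects ::
    "('o1, 'm1) cat \<Rightarrow> ('o2, 'm2) cat \<Rightarrow> ('o1, 'm1, 'o2, 'm2) func \<Rightarrow> bool" where
  "surj_on_objects C D F \<longleftrightarrow> fobj F ` obj C = obj D"


section \<open>Basic covers with an operation on subsets\<close>

text \<open>The data \<open>(S, \<lhd>, \<circ>)\<close>, with \<open>S\<close> a subset of an arbitrary type. The predicates below require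
  \<open>cov X \<subseteq> S \<times> Pow S\<close> and \<open>oper X\<close> to be extensional, so that two structures are equal in HOL iff
  they have the same carrier, the same cover and the same operation.\<close>

record 'a ocover =
  carr :: "'a set"
  cov :: "('a \<times> 'a set) set"
  oper :: "'a set \<times> 'a set \<Rightarrow> 'a set"

abbreviation oper_syntax :: "'a set \<Rightarrow> 'a ocover \<Rightarrow> 'a set \<Rightarrow> 'a set"
    ("(_ \<odot>\<^bsub>_\<^esub> _)" [71, 0, 71] 70) where
  "U \<odot>\<^bsub>X\<^esub> V \<equiv> oper X (U, V)"

definition covered :: "'a set \<Rightarrow> 'a ocover \<Rightarrow> 'a set \<Rightarrow> bool"
    ("(_ \<lhd>\<^bsub>_\<^esub> _)" [51, 0, 51] 50) where
  "U \<lhd>\<^bsub>X\<^esub> V \<longleftrightarrow> (\<forall>b\<in>U. (b, V) \<in> cov X)"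

definition saturate :: "'a ocover \<Rightarrow> 'a set \<Rightarrow> 'a set" where
  "saturate X U = {a \<in> carr X. (a, U) \<in> cov X}"

definition cov_eq :: "'a set \<Rightarrow> 'a ocover \<Rightarrow> 'a set \<Rightarrow> bool"
    ("(_ \<approx>\<^bsub>_\<^esub> _)" [51, 0, 51] 50) where
  "U \<approx>\<^bsub>X\<^esub> V \<longleftrightarrow> saturate X U = saturate X V"

definition basic_cover_on :: "'a set \<Rightarrow> ('a \<times> 'a set) set \<Rightarrow> bool" where
  "basic_cover_on S R \<longleftrightarrow> R \<subseteq> S \<times> Pow S \<and>
    (\<forall>U. U \<subseteq> S \<longrightarrow> (\<forall>a\<in>U. (a, U) \<in> R)) \<and>
    (\<forall>a U V. (a, U) \<in> R \<and> V \<subseteq> S \<and> (\<forall>b\<in>U. (b, V) \<in> R) \<longrightarrow> (a, V) \<in> R)"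

definition cover_with_op :: "'a ocover \<Rightarrow> bool" where
  "cover_with_op X \<longleftrightarrow> basic_cover_on (carr X) (cov X) \<and>
     oper X \<in> Pow (carr X) \<times> Pow (carr X) \<rightarrow>\<^sub>E Pow (carr X)"

definition circ_unit :: "'a ocover \<Rightarrow> 'a set \<Rightarrow> bool" where
  "circ_unit X E \<longleftrightarrow> E \<subseteq> carr X \<and> (\<forall>a\<in>carr X. {a} \<approx>\<^bsub>X\<^esub> {a} \<odot>\<^bsub>X\<^esub> E)"

text \<open>Indexed families are rendered as sets \<open>\<U>\<close> of subsets; the condition depends only on the
  range of the family.\<close>

definition circ_basic_cover :: "'a ocover \<Rightarrow> bool" where
  "circ_basic_cover X \<longleftrightarrow> cover_with_op X \<and>
    (\<forall>\<U> V. \<U> \<subseteq> Pow (carr X) \<and> V \<subseteq> carr X \<longrightarrow> (\<Union>U\<in>\<U>. U \<odot>\<^bsub>X\<^esub> V) \<approx>\<^bsub>X\<^esub> (\<Union>\<U>) \<odot>\<^bsub>X\<^esub> V) \<and>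
    (\<forall>U V W. U \<subseteq> carr X \<and> V \<subseteq> carr X \<and> W \<subseteq> carr X \<longrightarrow>
       (U \<odot>\<^bsub>X\<^esub> V) \<odot>\<^bsub>X\<^esub> W \<approx>\<^bsub>X\<^esub> U \<odot>\<^bsub>X\<^esub> (V \<odot>\<^bsub>X\<^esub> W)) \<and>
    (\<forall>U V. U \<subseteq> carr X \<and> V \<subseteq> carr X \<longrightarrow> U \<odot>\<^bsub>X\<^esub> V \<approx>\<^bsub>X\<^esub> V \<odot>\<^bsub>X\<^esub> U) \<and>
    (\<exists>E. circ_unit X E)"

definition Sat :: "'a ocover \<Rightarrow> 'a set set" where
  "Sat X = {U. U \<subseteq> carr X \<and> U = saturate X U}"

definition sat_join :: "'a ocover \<Rightarrow> 'a set set \<Rightarrow> 'a set" where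
  "sat_join X \<U> = saturate X (\<Union>\<U>)"

definition sat_op :: "'a ocover \<Rightarrow> 'a set \<Rightarrow> 'a set \<Rightarrow> 'a set" where
  "sat_op X P Q = saturate X (P \<odot>\<^bsub>X\<^esub> Q)"

definition convergent_cover :: "'a ocover \<Rightarrow> bool" where
  "convergent_cover X \<longleftrightarrow> cover_with_op X \<and>
    (\<forall>U1 U2 V1 V2. U1 \<subseteq> carr X \<and> U2 \<subseteq> carr X \<and> V1 \<subseteq> carr X \<and> V2 \<subseteq> carr X \<and>
       U1 \<lhd>\<^bsub>X\<^esub> V1 \<and> U2 \<lhd>\<^bsub>X\<^esub> V2 \<longrightarrow> U1 \<odot>\<^bsub>X\<^esub> U2 \<lhd>\<^bsub>X\<^esub> V1 \<odot>\<^bsub>X\<^esub> V2) \<and>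
    (\<forall>U V W. U \<subseteq> carr X \<and> V \<subseteq> carr X \<and> W \<subseteq> carr X \<longrightarrow>
       (U \<odot>\<^bsub>X\<^esub> V) \<odot>\<^bsub>X\<^esub> W \<lhd>\<^bsub>X\<^esub> U \<odot>\<^bsub>X\<^esub> (V \<odot>\<^bsub>X\<^esub> W)) \<and>
    (\<forall>U V. U \<subseteq> carr X \<and> V \<subseteq> carr X \<longrightarrow> U \<odot>\<^bsub>X\<^esub> V \<lhd>\<^bsub>X\<^esub> V \<odot>\<^bsub>X\<^esub> U) \<and>
    (\<forall>\<U> Q. \<U> \<subseteq> Sat X \<and> Q \<in> Sat X \<longrightarrow>
       sat_op X (sat_join X \<U>) Q = sat_join X ((\<lambda>P. sat_op X P Q) ` \<U>) \<and>
       sat_op X Q (sat_join X \<U>) = sat_join X ((\<lambda>P. sat_op X Q P) ` \<U>))"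

definition conv_unit :: "'a ocover \<Rightarrow> 'a set \<Rightarrow> bool" where
  "conv_unit X E \<longleftrightarrow> E \<subseteq> carr X \<and>
    (\<forall>a\<in>carr X. {a} \<odot>\<^bsub>X\<^esub> E \<approx>\<^bsub>X\<^esub> {a} \<and> {a} \<approx>\<^bsub>X\<^esub> E \<odot>\<^bsub>X\<^esub> {a})"

definition unital_convergent_cover :: "'a ocover \<Rightarrow> bool" where
  "unital_convergent_cover X \<longleftrightarrow> convergent_cover X \<and> (\<exists>E. conv_unit X E)"


section \<open>Inductive generation\<close>

definition axiom_set :: "'a set \<Rightarrow> ('a \<Rightarrow> 'i set) \<Rightarrow> ('a \<Rightarrow> 'i \<Rightarrow> 'a set) \<Rightarrow> bool" where
  "axiom_set S I C \<longleftrightarrow> (\<forall>a\<in>S. \<forall>i\<in>I a. C a i \<subseteq> S)"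

inductive_set gen_cover :: "'a set \<Rightarrow> ('a \<Rightarrow> 'i set) \<Rightarrow> ('a \<Rightarrow> 'i \<Rightarrow> 'a set) \<Rightarrow> ('a \<times> 'a set) set"
  for S :: "'a set" and I :: "'a \<Rightarrow> 'i set" and C :: "'a \<Rightarrow> 'i \<Rightarrow> 'a set" where
  refl: "\<lbrakk>U \<subseteq> S; a \<in> U\<rbrakk> \<Longrightarrow> (a, U) \<in> gen_cover S I C"
| infer: "\<lbrakk>U \<subseteq> S; a \<in> S; i \<in> I a; \<And>b. b \<in> C a i \<Longrightarrow> (b, U) \<in> gen_cover S I C\<rbrakk>
    \<Longrightarrow> (a, U) \<in> gen_cover S I C"

lemma gen_cover_basic: "basic_cover_on S (gen_cover S I C)"
proof -
  have sub: "a \<in> S \<and> U \<subseteq> S" if "(a, U) \<in> gen_cover S I C" for a U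
    using that by (induction rule: gen_cover.induct) auto
  have trans: "(a, V) \<in> gen_cover S I C"
    if "(a, U) \<in> gen_cover S I C" "V \<subseteq> S" "\<forall>b\<in>U. (b, V) \<in> gen_cover S I C" for a U V
    using that by (induction rule: gen_cover.induct) (auto intro: gen_cover.infer)
  show ?thesis
    unfolding basic_cover_on_def
  proof (intro conjI allI impI)
    show "gen_cover S I C \<subseteq> S \<times> Pow S" using sub by auto
    show "\<forall>a\<in>U. (a, U) \<in> gen_cover S I C" if "U \<subseteq> S" for U
      using that by (simp add: gen_cover.refl)
    show "(a, V) \<in> gen_cover S I C"
      if "(a, U) \<in> gen_cover S I C \<and> V \<subseteq> S \<and> (\<forall>b\<in>U. (b, V) \<in> gen_cover S I C)" for a U V
      using that trans[of a U V] by simp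
  qed
qed

lemma gen_cover_axiom:
  assumes "axiom_set S I C" "a \<in> S" "i \<in> I a"
  shows "(a, C a i) \<in> gen_cover S I C"
  using assms unfolding axiom_set_def by (blast intro: gen_cover.intros)

lemma gen_cover_least:
  assumes R: "basic_cover_on S R"
    and ax: "\<And>a i. a \<in> S \<Longrightarrow> i \<in> I a \<Longrightarrow> (a, C a i) \<in> R"
  shows "gen_cover S I C \<subseteq> R"
proof -
  have "(a, U) \<in> R" if "(a, U) \<in> gen_cover S I C" for a U
    using that
  proof (induction rule: gen_cover.induct)
    case (refl U a)
    then show ?case using R by (simp add: basic_cover_on_def)
  next
    case (infer U a i)
    have "(a, U) \<in> R" if "(a, V) \<in> R" "U \<subseteq> S" "\<forall>b\<in>V. (b, U) \<in> R" for V
      using R that unfolding basic_cover_on_def by metis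
    from this[OF ax[OF infer(2,3)] infer(1)] infer show ?case by blast
  qed
  then show ?thesis by auto
qed

text \<open>Existentially quantified axiom-sets are indexed by \<open>'a set\<close>. This is no restriction: the
  generated cover depends only on the collections \<open>{C a i | i \<in> I a}\<close> of subsets, so any axiom-set
  may be replaced by one whose indices are these subsets themselves. The lemmas \<open>gen_cover_reindex\<close>
  and, for convergent covers, \<open>conv_axioms_reindex\<close> below confirm this.\<close>

definition ind_gen_basic :: "'a ocover \<Rightarrow> bool" where
  "ind_gen_basic X \<longleftrightarrow> (\<exists>(I :: 'a \<Rightarrow> 'a set set) C.
     axiom_set (carr X) I C \<and> cov X = gen_cover (carr X) I C)"

lemma gen_cover_mono:
  assumes "\<And>a i. a \<in> S \<Longrightarrow> i \<in> I a \<Longrightarrow> C a i \<in> C' a ` I' a"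
  shows "gen_cover S I C \<subseteq> gen_cover S I' C'"
proof -
  have "(a, U) \<in> gen_cover S I' C'" if "(a, U) \<in> gen_cover S I C" for a U
    using that
  proof (induction rule: gen_cover.induct)
    case (refl U a)
    then show ?case by (rule gen_cover.refl)
  next
    case (infer U a i)
    then obtain j where "j \<in> I' a" "C a i = C' a j" using assms[of a i] by auto
    with infer show ?case by (intro gen_cover.infer[of U S a j I' C']) simp_all
  qed
  then show ?thesis by auto
qed

lemma gen_cover_reindex: "gen_cover S I C = gen_cover S (\<lambda>a. C a ` I a) (\<lambda>a U. U)"
  by (intro subset_antisym gen_cover_mono) auto

definition op_of :: "('a \<Rightarrow> 'a \<Rightarrow> 'a set) \<Rightarrow> 'a set \<Rightarrow> 'a set \<Rightarrow> 'a set" where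
  "op_of \<delta> U V = (\<Union>a\<in>U. \<Union>b\<in>V. \<delta> a b)"

datatype ('a, 'i) J_index = Given 'i | Comm 'a 'a | Assoc 'a 'a 'a

definition J_set ::
    "'a set \<Rightarrow> ('a \<Rightarrow> 'i set) \<Rightarrow> ('a \<Rightarrow> 'a \<Rightarrow> 'a set) \<Rightarrow> 'a \<Rightarrow> ('a, 'i) J_index set" where
  "J_set S I \<delta> a =
     Given ` I a \<union>
     {Comm b c | b c. b \<in> S \<and> c \<in> S \<and> a \<in> \<delta> b c} \<union>
     {Assoc b c d | b c d. b \<in> S \<and> c \<in> S \<and> d \<in> S \<and> a \<in> op_of \<delta> (\<delta> b c) {d}}"

fun D_sub :: "('a \<Rightarrow> 'i \<Rightarrow> 'a set) \<Rightarrow> ('a \<Rightarrow> 'a \<Rightarrow> 'a set) \<Rightarrow> 'a \<Rightarrow> ('a, 'i) J_index \<Rightarrow> 'a set" where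
  "D_sub C \<delta> a (Given i) = C a i"
| "D_sub C \<delta> a (Comm b c) = \<delta> c b"
| "D_sub C \<delta> a (Assoc b c d) = op_of \<delta> {b} (\<delta> c d)"

datatype ('a, 'j) stab_index = Plain 'j | Stab 'a 'a 'j

definition stab_set ::
    "'a set \<Rightarrow> ('a \<Rightarrow> 'j set) \<Rightarrow> ('a \<Rightarrow> 'a \<Rightarrow> 'a set) \<Rightarrow> 'a \<Rightarrow> ('a, 'j) stab_index set" where
  "stab_set S J \<delta> a =
     Plain ` J a \<union> {Stab b c j | b c j. b \<in> S \<and> c \<in> S \<and> a \<in> \<delta> b c \<and> j \<in> J b}"

fun stab_sub ::
    "('a \<Rightarrow> 'j \<Rightarrow> 'a set) \<Rightarrow> ('a \<Rightarrow> 'a \<Rightarrow> 'a set) \<Rightarrow> 'a \<Rightarrow> ('a, 'j) stab_index \<Rightarrow> 'a set" where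
  "stab_sub D \<delta> a (Plain j) = D a j"
| "stab_sub D \<delta> a (Stab b c j) = op_of \<delta> (D b j) {c}"

definition conv_ocover ::
    "'a set \<Rightarrow> ('a \<Rightarrow> 'i set) \<Rightarrow> ('a \<Rightarrow> 'i \<Rightarrow> 'a set) \<Rightarrow> ('a \<Rightarrow> 'a \<Rightarrow> 'a set) \<Rightarrow> 'a ocover" where
  "conv_ocover S I C \<delta> =
     \<lparr>carr = S,
      cov = gen_cover S (stab_set S (J_set S I \<delta>) \<delta>) (stab_sub (D_sub C \<delta>) \<delta>),
      oper = restrict (\<lambda>(U, V). op_of \<delta> U V) (Pow S \<times> Pow S)\<rparr>"

definition ind_gen_convergent :: "'a ocover \<Rightarrow> bool" where
  "ind_gen_convergent X \<longleftrightarrow> (\<exists>(I :: 'a \<Rightarrow> 'a set set) C \<delta>.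
     axiom_set (carr X) I C \<and>
     (\<forall>a\<in>carr X. \<forall>b\<in>carr X. \<delta> a b \<subseteq> carr X) \<and>
     X = conv_ocover (carr X) I C \<delta>)"

lemma conv_axioms_reindex: "conv_ocover S I C \<delta> = conv_ocover S (\<lambda>a. C a ` I a) (\<lambda>a U. U) \<delta>"
proof -
  let ?I = "\<lambda>a. C a ` I a" and ?C = "\<lambda>a U. U"
  have 1: "\<exists>k\<in>J_set S ?I \<delta> a. D_sub C \<delta> a j = D_sub ?C \<delta> a k" if "j \<in> J_set S I \<delta> a" for a j
  proof (cases j)
    case (Given i)
    with that show ?thesis by (intro bexI[of _ "Given (C a i)"]) (auto simp: J_set_def)
  next
    case (Comm b c)
    with that show ?thesis by (intro bexI[of _ "Comm b c"]) (auto simp: J_set_def)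
  next
    case (Assoc b c d)
    with that show ?thesis by (intro bexI[of _ "Assoc b c d"]) (auto simp: J_set_def)
  qed
  have 2: "\<exists>j\<in>J_set S I \<delta> a. D_sub ?C \<delta> a k = D_sub C \<delta> a j" if "k \<in> J_set S ?I \<delta> a" for a k
  proof (cases k)
    case (Given U)
    with that obtain i where "i \<in> I a" "U = C a i" by (auto simp: J_set_def)
    with Given show ?thesis by (intro bexI[of _ "Given i"]) (auto simp: J_set_def)
  next
    case (Comm b c)
    with that show ?thesis by (intro bexI[of _ "Comm b c"]) (auto simp: J_set_def)
  next
    case (Assoc b c d)
    with that show ?thesis by (intro bexI[of _ "Assoc b c d"]) (auto simp: J_set_def)
  qed
  have stab: "stab_sub D \<delta> a x \<in> stab_sub D' \<delta> a ` stab_set S K' \<delta> a"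
    if *: "\<And>b j. j \<in> K b \<Longrightarrow> \<exists>k\<in>K' b. D b j = D' b k" and x: "x \<in> stab_set S K \<delta> a"
    for D :: "'a \<Rightarrow> 'j \<Rightarrow> 'a set" and D' :: "'a \<Rightarrow> 'k \<Rightarrow> 'a set" and K K' a x
  proof (cases x)
    case (Plain j)
    with x have "j \<in> K a" by (auto simp: stab_set_def)
    with * obtain k where "k \<in> K' a" "D a j = D' a k" by blast
    with Plain show ?thesis by (intro image_eqI[of _ _ "Plain k"]) (auto simp: stab_set_def)
  next
    case (Stab b c j)
    with x have bc: "j \<in> K b" "b \<in> S" "c \<in> S" "a \<in> \<delta> b c" by (auto simp: stab_set_def)
    with * obtain k where "k \<in> K' b" "D b j = D' b k" by blast
    with Stab bc show ?thesis by (intro image_eqI[of _ _ "Stab b c k"]) (auto simp: stab_set_def)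
  qed
  have "gen_cover S (stab_set S (J_set S I \<delta>) \<delta>) (stab_sub (D_sub C \<delta>) \<delta>) =
        gen_cover S (stab_set S (J_set S ?I \<delta>) \<delta>) (stab_sub (D_sub ?C \<delta>) \<delta>)"
    by (rule subset_antisym; rule gen_cover_mono; rule stab[OF 1] stab[OF 2])
  then show ?thesis by (simp add: conv_ocover_def)
qed


section \<open>Morphisms\<close>

text \<open>For \<open>r \<subseteq> S \<times> T\<close> and \<open>V \<subseteq> T\<close> the set \<open>r\<^sup>-V\<close> is \<open>r\<inverse> `` V\<close>.\<close>

definition basic_cover_map :: "'a ocover \<Rightarrow> 'a ocover \<Rightarrow> 'a rel \<Rightarrow> bool" where
  "basic_cover_map X Y r \<longleftrightarrow> r \<subseteq> carr X \<times> carr Y \<and>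
    (\<forall>b V. (b, V) \<in> cov Y \<longrightarrow> r\<inverse> `` {b} \<lhd>\<^bsub>X\<^esub> r\<inverse> `` V)"

definition map_eq :: "'a ocover \<Rightarrow> 'a ocover \<Rightarrow> 'a rel \<Rightarrow> 'a rel \<Rightarrow> bool" where
  "map_eq X Y r1 r2 \<longleftrightarrow> (\<forall>b\<in>carr Y. r1\<inverse> `` {b} \<approx>\<^bsub>X\<^esub> r2\<inverse> `` {b})"

text \<open>Units are only determined up to \<open>\<approx>\<close> (cf. \<open>circ_unit_unique\<close>), and the condition on units below
  does not depend on the choice.\<close>

definition circ_cover_map :: "'a ocover \<Rightarrow> 'a ocover \<Rightarrow> 'a rel \<Rightarrow> bool" where
  "circ_cover_map X Y r \<longleftrightarrow> basic_cover_map X Y r \<and>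
    (\<forall>U V. U \<subseteq> carr Y \<and> V \<subseteq> carr Y \<longrightarrow>
       r\<inverse> `` (U \<odot>\<^bsub>Y\<^esub> V) \<approx>\<^bsub>X\<^esub> (r\<inverse> `` U) \<odot>\<^bsub>X\<^esub> (r\<inverse> `` V)) \<and>
    (\<forall>E E'. circ_unit X E \<and> circ_unit Y E' \<longrightarrow> r\<inverse> `` E' \<approx>\<^bsub>X\<^esub> E)"

definition unital_convergent_cover_map :: "'a ocover \<Rightarrow> 'a ocover \<Rightarrow> 'a rel \<Rightarrow> bool" where
  "unital_convergent_cover_map X Y r \<longleftrightarrow> basic_cover_map X Y r \<and>
    (\<forall>b1\<in>carr Y. \<forall>b2\<in>carr Y.
       r\<inverse> `` ({b1} \<odot>\<^bsub>Y\<^esub> {b2}) \<approx>\<^bsub>X\<^esub> (r\<inverse> `` {b1}) \<odot>\<^bsub>X\<^esub> (r\<inverse> `` {b2})) \<and>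
    (\<forall>E E'. conv_unit X E \<and> conv_unit Y E' \<longrightarrow> r\<inverse> `` E' \<approx>\<^bsub>X\<^esub> E)"

lemma circ_unit_unique:
  assumes X: "circ_basic_cover X" and E: "circ_unit X E" and E': "circ_unit X E'"
  shows "E \<approx>\<^bsub>X\<^esub> E'"
proof -
  have sub: "E \<subseteq> carr X" "E' \<subseteq> carr X" using E E' by (auto simp: circ_unit_def)
  have bc: "basic_cover_on (carr X) (cov X)"
    and ty: "oper X \<in> Pow (carr X) \<times> Pow (carr X) \<rightarrow> Pow (carr X)"
    using X by (auto simp: circ_basic_cover_def cover_with_op_def PiE_def)
  have distr: "(\<Union>U\<in>\<U>. U \<odot>\<^bsub>X\<^esub> V) \<approx>\<^bsub>X\<^esub> (\<Union>\<U>) \<odot>\<^bsub>X\<^esub> V"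
    if "\<U> \<subseteq> Pow (carr X)" "V \<subseteq> carr X" for \<U> V
    using X that by (simp add: circ_basic_cover_def)
  have comm: "E \<odot>\<^bsub>X\<^esub> E' \<approx>\<^bsub>X\<^esub> E' \<odot>\<^bsub>X\<^esub> E"
    using X sub by (simp add: circ_basic_cover_def)
  have incl: "(a, U) \<in> cov X" if "U \<subseteq> carr X" "a \<in> U" for a U
    using bc that by (simp add: basic_cover_on_def)
  have tr: "(a, V) \<in> cov X" if "(a, U) \<in> cov X" "V \<subseteq> carr X" "\<forall>b\<in>U. (b, V) \<in> cov X" for a U V
    using bc that unfolding basic_cover_on_def by metis
  have eqI: "U \<approx>\<^bsub>X\<^esub> V" if "U \<subseteq> carr X" "V \<subseteq> carr X" "U \<lhd>\<^bsub>X\<^esub> V" "V \<lhd>\<^bsub>X\<^esub> U" for U V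
    using that tr[of _ U V] tr[of _ V U] by (auto simp: cov_eq_def saturate_def covered_def)
  have eqD: "U \<lhd>\<^bsub>X\<^esub> V" if "U \<approx>\<^bsub>X\<^esub> V" "U \<subseteq> carr X" for U V
    using that incl[of U] by (auto simp: cov_eq_def saturate_def covered_def set_eq_iff)
  have mono: "(a, V) \<in> cov X" if "(a, U) \<in> cov X" "U \<subseteq> V" "V \<subseteq> carr X" for a U V
    using that incl[of V] by (intro tr[of a U V]) auto
  have *: "A \<approx>\<^bsub>X\<^esub> A \<odot>\<^bsub>X\<^esub> B" if A: "A \<subseteq> carr X" and B: "circ_unit X B" for A B
  proof -
    have BS: "B \<subseteq> carr X" using B by (simp add: circ_unit_def)
    have un: "{a} \<approx>\<^bsub>X\<^esub> {a} \<odot>\<^bsub>X\<^esub> B" if "a \<in> A" for a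
      using B A that by (auto simp: circ_unit_def)
    have opS: "{a} \<odot>\<^bsub>X\<^esub> B \<subseteq> carr X" if "a \<in> A" for a
      using ty A BS that by (auto simp: Pi_iff)
    let ?W = "\<Union>a\<in>A. {a} \<odot>\<^bsub>X\<^esub> B"
    have WS: "?W \<subseteq> carr X" using opS by blast
    have "A \<approx>\<^bsub>X\<^esub> ?W"
    proof (rule eqI)
      show "A \<lhd>\<^bsub>X\<^esub> ?W"
        unfolding covered_def
      proof
        fix a assume a: "a \<in> A"
        have "(a, {a} \<odot>\<^bsub>X\<^esub> B) \<in> cov X"
          using eqD[OF un[OF a]] a A by (auto simp: covered_def)
        then show "(a, ?W) \<in> cov X" by (rule mono) (use a WS in auto)
      qed
      show "?W \<lhd>\<^bsub>X\<^esub> A"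
        unfolding covered_def
      proof
        fix w assume "w \<in> ?W"
        then obtain a where a: "a \<in> A" "w \<in> {a} \<odot>\<^bsub>X\<^esub> B" by blast
        have "(w, {a}) \<in> cov X"
          using eqD[of "{a} \<odot>\<^bsub>X\<^esub> B" "{a}"] un[OF a(1)] opS[OF a(1)] a(2)
          by (auto simp: covered_def cov_eq_def)
        then show "(w, A) \<in> cov X" by (rule mono) (use a A in auto)
      qed
    qed (use A WS in auto)
    moreover have "?W \<approx>\<^bsub>X\<^esub> A \<odot>\<^bsub>X\<^esub> B"
    proof -
      have "(\<lambda>a. {a}) ` A \<subseteq> Pow (carr X)" using A by auto
      from distr[OF this BS] show ?thesis by (simp add: image_image)
    qed
    ultimately show ?thesis by (simp add: cov_eq_def)
  qed
  show ?thesis using *[OF sub(1) E'] *[OF sub(2) E] comm by (simp add: cov_eq_def)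
qed


section \<open>The two categories\<close>

text \<open>Arrows are basic cover maps up to \<open>map_eq\<close>: an arrow is the class of all basic cover maps
  equal to a given one, in each category, and composition is relational composition of
  representatives (in HOL, \<open>r O s\<close> is first \<open>r\<close>, then \<open>s\<close>).\<close>

definition map_class :: "'a ocover \<Rightarrow> 'a ocover \<Rightarrow> 'a rel \<Rightarrow> 'a rel set" where
  "map_class X Y r = {t. basic_cover_map X Y t \<and> map_eq X Y r t}"

definition comp_class ::
    "'a ocover \<Rightarrow> 'a ocover \<Rightarrow> 'a ocover \<Rightarrow> 'a rel set \<Rightarrow> 'a rel set \<Rightarrow> 'a rel set" where
  "comp_class X Y Z g f = (\<Union>r\<in>f. \<Union>s\<in>g. map_class X Z (r O s))"

definition BCov_circ_i :: "('a ocover, 'a rel set) cat" where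
  "BCov_circ_i =
     \<lparr>obj = {X. circ_basic_cover X \<and> ind_gen_basic X},
      hom = (\<lambda>X Y. map_class X Y ` {r. circ_cover_map X Y r}),
      cat_comp = comp_class,
      ident = (\<lambda>X. map_class X X (Id_on (carr X)))\<rparr>"

definition uCBCov_i :: "('a ocover, 'a rel set) cat" where
  "uCBCov_i =
     \<lparr>obj = {X. unital_convergent_cover X \<and> ind_gen_convergent X},
      hom = (\<lambda>X Y. map_class X Y ` {r. unital_convergent_cover_map X Y r}),
      cat_comp = comp_class,
      ident = (\<lambda>X. map_class X X (Id_on (carr X)))\<rparr>"

definition forgetful :: "('a ocover, 'a rel set, 'a ocover, 'a rel set) func" where
  "forgetful = \<lparr>fobj = (\<lambda>X. X), fmap = (\<lambda>X Y f. f)\<rparr>"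

end

theory Submission
  imports Defs
begin

text \<open>
  On unital convergent covers that are inductively generated, the operation is determined by its
  values on singletons, so a relation between two such covers is a unital convergent cover map iff
  it is a \<open>\<circ>\<close>-basic cover map. Hence the forgetful functor is the inclusion of a full
  subcategory, and a right adjoint is a coreflection onto it.

  A \<open>\<circ>\<close>-basic cover \<open>Y\<close> fails to be convergent only because \<open>\<circ>\<close> need not respect the cover: its
  operation is already commutative, associative and determined by singletons, up to equality of
  saturations. The coreflection \<open>Q Y\<close> keeps the carrier, replaces \<open>\<circ>\<close> by its extension from
  singletons, and enlarges the cover of \<open>Y\<close> to the least one that is stable under \<open>\<circ>\<close>; this is the
  convergent cover generated by all instances \<open>a \<lhd> U\<close> and \<open>\<delta> a b = {a} \<circ> {b}\<close>. That stability on
  generators suffices is the lemma \<open>localization\<close>.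

  If \<open>X\<close> is convergent and \<open>r : X \<rightarrow> Y\<close> is a \<open>\<circ>\<close>-basic cover map, then the pairs \<open>(b, V)\<close> with
  \<open>r\<^sup>-b \<lhd> r\<^sup>-V\<close> form a basic cover that contains the generators of \<open>Q Y\<close>, because \<open>r\<^sup>-\<close> turns the
  operation of \<open>Y\<close> into that of \<open>X\<close>, where stability holds (\<open>basic_cover_map_coreflection\<close>). So the
  same relations are maps \<open>X \<rightarrow> Y\<close> and \<open>X \<rightarrow> Q Y\<close>. Equality of maps involves only the cover of the
  source and the points of the target, so the arrows \<open>X \<rightarrow> Y\<close> and \<open>X \<rightarrow> Q Y\<close> are literally the same
  classes of relations, and the counit is the class of the identity relation. Finally, \<open>Q X = X\<close> if
  \<open>X\<close> was convergent and inductively generated already, which gives surjectivity on objects.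
\<close>

section \<open>Coreflective full subcategories\<close>

text \<open>The situation to which the theorem reduces: a full subcategory \<open>C\<close> of \<open>D\<close> and arrows
  \<open>e Y : q Y \<rightarrow> Y\<close> such that composition with \<open>e Y\<close> is not merely a bijection from arrows \<open>X \<rightarrow> q Y\<close>
  to arrows \<open>X \<rightarrow> Y\<close> but the identity on one common set. The transposition of the adjunction is then
  the identity, and the right adjoint sends \<open>f : Y \<rightarrow> Y'\<close> to \<open>f \<circ> e Y\<close>, read as an arrow into
  \<open>q Y'\<close>.\<close>

lemma coreflection_right_adjoint:
  fixes C D :: "('o, 'm) cat"
  assumes D: "is_category D"
    and obj: "obj C \<subseteq> obj D"
    and hom: "\<And>X Y. X \<in> obj C \<Longrightarrow> Y \<in> obj C \<Longrightarrow> hom C X Y = hom D X Y"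
    and comp: "cat_comp C = cat_comp D" and ident: "ident C = ident D"
    and q: "\<And>Y. Y \<in> obj D \<Longrightarrow> q Y \<in> obj C"
    and e: "\<And>Y. Y \<in> obj D \<Longrightarrow> e Y \<in> hom D (q Y) Y"
    and hom_q: "\<And>X Y. X \<in> obj C \<Longrightarrow> Y \<in> obj D \<Longrightarrow> hom D X (q Y) = hom D X Y"
    and e_comp: "\<And>X Y f. X \<in> obj C \<Longrightarrow> Y \<in> obj D \<Longrightarrow> f \<in> hom D X (q Y) \<Longrightarrow>
                   cat_comp D X (q Y) Y (e Y) f = f"
  shows "is_right_adjoint C D \<lparr>fobj = \<lambda>X. X, fmap = \<lambda>X Y f. f\<rparr>
           \<lparr>fobj = q, fmap = \<lambda>Y Y' f. cat_comp D (q Y) Y Y' f (e Y)\<rparr>"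
proof -
  let ?c = "cat_comp D"
  let ?F = "\<lparr>fobj = \<lambda>X. X, fmap = \<lambda>X Y f. f\<rparr>"
  let ?G = "\<lparr>fobj = q, fmap = \<lambda>Y Y' f. ?c (q Y) Y Y' f (e Y)\<rparr>"
  have id: "ident D X \<in> hom D X X" if "X \<in> obj D" for X
    using D that by (simp add: is_category_def)
  have cl: "?c X Y Z g f \<in> hom D X Z"
    if "X \<in> obj D" "Y \<in> obj D" "Z \<in> obj D" "f \<in> hom D X Y" "g \<in> hom D Y Z" for X Y Z f g
    using D that by (simp add: is_category_def)
  have idl: "?c X Y Y (ident D Y) f = f" and idr: "?c X X Y f (ident D X) = f"
    if "X \<in> obj D" "Y \<in> obj D" "f \<in> hom D X Y" for X Y f
    using D that by (simp_all add: is_category_def)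
  have assoc: "?c W X Z (?c X Y Z h g) f = ?c W Y Z h (?c W X Y g f)"
    if "W \<in> obj D" "X \<in> obj D" "Y \<in> obj D" "Z \<in> obj D"
       "f \<in> hom D W X" "g \<in> hom D X Y" "h \<in> hom D Y Z" for W X Y Z f g h
    using D that unfolding is_category_def by blast
  have CD: "X \<in> obj D" if "X \<in> obj C" for X using obj that by blast
  have qD: "q Y \<in> obj D" if "Y \<in> obj D" for Y using q CD that by blast
  \<comment> \<open>An arrow into \<open>Y\<close> is also one into \<open>q Y\<close>; composition gives the same result in both readings,
    since the two results differ by a composition with \<open>e Y\<close>.\<close>
  have retarget: "?c X W (q Y) g f = ?c X W Y g f"
    if X: "X \<in> obj C" and W: "W \<in> obj C" and Y: "Y \<in> obj D"
      and f: "f \<in> hom D X W" and g: "g \<in> hom D W Y" for X W Y g f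
  proof -
    have g': "g \<in> hom D W (q Y)" using g hom_q[OF W Y] by simp
    have "?c X W (q Y) g f = ?c X (q Y) Y (e Y) (?c X W (q Y) g f)"
      using e_comp[OF X Y cl[OF CD[OF X] CD[OF W] qD[OF Y] f g']] by simp
    also have "\<dots> = ?c X W Y (?c W (q Y) Y (e Y) g) f"
      using assoc[OF CD[OF X] CD[OF W] qD[OF Y] Y f g' e[OF Y]] by simp
    finally show ?thesis using e_comp[OF W Y g'] by simp
  qed
  have Qhom: "?c (q Y) Y Y' k (e Y) \<in> hom D (q Y) (q Y')"
    if "Y \<in> obj D" "Y' \<in> obj D" "k \<in> hom D Y Y'" for Y Y' k
    using that cl[OF qD that(1,2) e that(3)] hom_q q by blast
  have Qcomp: "?c X (q Y) (q Y') (?c (q Y) Y Y' k (e Y)) f = ?c X Y Y' k f"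
    if X: "X \<in> obj C" and Y: "Y \<in> obj D" and Y': "Y' \<in> obj D"
      and k: "k \<in> hom D Y Y'" and f: "f \<in> hom D X (q Y)" for X Y Y' k f
  proof -
    have "?c X (q Y) (q Y') (?c (q Y) Y Y' k (e Y)) f = ?c X (q Y) Y' (?c (q Y) Y Y' k (e Y)) f"
      by (rule retarget[OF X q[OF Y] Y' f]) (use cl[OF qD[OF Y] Y Y' e[OF Y] k] in simp)
    also have "\<dots> = ?c X Y Y' k f"
      using assoc[OF CD[OF X] qD[OF Y] Y Y' f e[OF Y] k] e_comp[OF X Y f] by simp
    finally show ?thesis .
  qed
  have e_id: "e Y = ident D (q Y)" if Y: "Y \<in> obj D" for Y
    using e_comp[OF q[OF Y] Y id[OF qD[OF Y]]] idr[OF qD[OF Y] Y e[OF Y]] by simp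
  have C: "is_category C"
    unfolding is_category_def comp ident using hom id cl idl idr assoc CD by auto
  have F: "is_functor C D ?F"
    unfolding is_functor_def using C D hom CD comp ident by simp
  have G: "is_functor D C ?G"
    unfolding is_functor_def
  proof (intro conjI ballI)
    fix X Y Z f g
    assume XYZ: "X \<in> obj D" "Y \<in> obj D" "Z \<in> obj D" and f: "f \<in> hom D X Y" and g: "g \<in> hom D Y Z"
    have "?c (q X) X Z (?c X Y Z g f) (e X) = ?c (q X) Y Z g (?c (q X) X Y f (e X))"
      using assoc[OF qD XYZ e f g] XYZ by simp
    also have "\<dots> = ?c (q X) (q Y) (q Z) (?c (q Y) Y Z g (e Y)) (?c (q X) X Y f (e X))"
      using Qcomp[OF q XYZ(2,3) g Qhom[OF XYZ(1,2) f]] XYZ by simp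
    finally show "fmap ?G X Z (?c X Y Z g f) =
      cat_comp C (fobj ?G X) (fobj ?G Y) (fobj ?G Z) (fmap ?G Y Z g) (fmap ?G X Y f)"
      by (simp add: comp)
  qed (use C D q qD Qhom hom e idl e_id ident in auto)
  have nat: "?c X' Y Y' k (?c X' X Y f h) =
      ?c X' (q Y) (q Y') (?c (q Y) Y Y' k (e Y)) (?c X' X (q Y) f h)"
    if "X \<in> obj C" "X' \<in> obj C" "Y \<in> obj D" "Y' \<in> obj D"
       "h \<in> hom D X' X" "k \<in> hom D Y Y'" "f \<in> hom D X Y" for X X' Y Y' h k f
    using Qcomp[OF that(2-4,6), of "?c X' X Y f h"] retarget[OF that(2,1,3,5,7)]
      cl[OF CD[OF that(2)] CD[OF that(1)] that(3,5,7)] hom_q[OF that(2,3)] by simp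
  show ?thesis
    unfolding is_right_adjoint_def
  proof (intro conjI F G exI[of _ "\<lambda>X Y f. f"] ballI)
    show "bij_betw (\<lambda>f. f) (hom D (fobj ?F X) Y) (hom C X (fobj ?G Y))"
      if "X \<in> obj C" "Y \<in> obj D" for X Y
      using hom[OF that(1) q[OF that(2)]] hom_q[OF that] by (simp add: bij_betw_def)
  qed (use nat hom comp in auto)
qed


section \<open>Calculus of basic covers\<close>

abbreviation basic_cover :: "'a ocover \<Rightarrow> bool" where
  "basic_cover X \<equiv> basic_cover_on (carr X) (cov X)"

lemma cov_in_carr: "basic_cover X \<Longrightarrow> (a, U) \<in> cov X \<Longrightarrow> a \<in> carr X \<and> U \<subseteq> carr X"
  by (drule basic_cover_on_def[THEN iffD1, THEN conjunct1]) blast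

lemma covered_subset: "basic_cover X \<Longrightarrow> V \<subseteq> carr X \<Longrightarrow> U \<subseteq> V \<Longrightarrow> U \<lhd>\<^bsub>X\<^esub> V"
  by (drule basic_cover_on_def[THEN iffD1, THEN conjunct2, THEN conjunct1])
    (auto simp: covered_def)

lemma covered_trans:
  assumes "basic_cover X" "U \<lhd>\<^bsub>X\<^esub> V" "V \<lhd>\<^bsub>X\<^esub> W" "W \<subseteq> carr X"
  shows "U \<lhd>\<^bsub>X\<^esub> W"
  unfolding covered_def
proof
  fix b assume "b \<in> U"
  then have 1: "(b, V) \<in> cov X \<and> W \<subseteq> carr X \<and> (\<forall>c\<in>V. (c, W) \<in> cov X)"
    using assms by (simp add: covered_def)
  have 2: "\<forall>a U V. (a, U) \<in> cov X \<and> V \<subseteq> carr X \<and> (\<forall>b\<in>U. (b, V) \<in> cov X) \<longrightarrow> (a, V) \<in> cov X"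
    by (rule assms(1)[unfolded basic_cover_on_def, THEN conjunct2, THEN conjunct2])
  show "(b, W) \<in> cov X"
    by (rule mp[OF spec[OF spec[OF spec[OF 2, of b], of V], of W] 1])
qed

lemma covered_UN: "(\<Union>i\<in>A. F i) \<lhd>\<^bsub>X\<^esub> V \<longleftrightarrow> (\<forall>i\<in>A. F i \<lhd>\<^bsub>X\<^esub> V)"
  unfolding covered_def by blast

lemma cov_eq_iff:
  assumes X: "basic_cover X" and U: "U \<subseteq> carr X" and V: "V \<subseteq> carr X"
  shows "U \<approx>\<^bsub>X\<^esub> V \<longleftrightarrow> U \<lhd>\<^bsub>X\<^esub> V \<and> V \<lhd>\<^bsub>X\<^esub> U"
proof
  assume "U \<approx>\<^bsub>X\<^esub> V"
  then show "U \<lhd>\<^bsub>X\<^esub> V \<and> V \<lhd>\<^bsub>X\<^esub> U"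
    using covered_subset[OF X U order_refl] covered_subset[OF X V order_refl] U V
    unfolding cov_eq_def saturate_def covered_def by blast
next
  assume *: "U \<lhd>\<^bsub>X\<^esub> V \<and> V \<lhd>\<^bsub>X\<^esub> U"
  have "(a, U) \<in> cov X \<longleftrightarrow> (a, V) \<in> cov X" for a
    using covered_trans[OF X, of "{a}" U V] covered_trans[OF X, of "{a}" V U] * U V
    by (auto simp: covered_def)
  then show "U \<approx>\<^bsub>X\<^esub> V" by (simp add: cov_eq_def saturate_def)
qed

lemma cov_eq_refl: "U \<approx>\<^bsub>X\<^esub> U"
  and cov_eq_sym: "U \<approx>\<^bsub>X\<^esub> V \<Longrightarrow> V \<approx>\<^bsub>X\<^esub> U"
  and cov_eq_trans [trans]: "U \<approx>\<^bsub>X\<^esub> V \<Longrightarrow> V \<approx>\<^bsub>X\<^esub> W \<Longrightarrow> U \<approx>\<^bsub>X\<^esub> W"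
  by (simp_all add: cov_eq_def)

lemma cov_eq_UN:
  assumes X: "basic_cover X" and FG: "\<And>i. i \<in> A \<Longrightarrow> F i \<subseteq> carr X \<and> G i \<subseteq> carr X \<and> F i \<approx>\<^bsub>X\<^esub> G i"
  shows "(\<Union>i\<in>A. F i) \<approx>\<^bsub>X\<^esub> (\<Union>i\<in>A. G i)"
proof -
  have *: "(\<Union>i\<in>A. F i) \<lhd>\<^bsub>X\<^esub> (\<Union>i\<in>A. G i)"
    if "\<And>i. i \<in> A \<Longrightarrow> G i \<subseteq> carr X \<and> F i \<lhd>\<^bsub>X\<^esub> G i" for F G
    unfolding covered_UN
  proof
    fix i assume i: "i \<in> A"
    have G: "(\<Union>i\<in>A. G i) \<subseteq> carr X" using that by blast
    show "F i \<lhd>\<^bsub>X\<^esub> (\<Union>i\<in>A. G i)"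
      using that[OF i] i by (intro covered_trans[OF X _ covered_subset[OF X G] G, of _ "G i"]) auto
  qed
  have FG': "F i \<lhd>\<^bsub>X\<^esub> G i" "G i \<lhd>\<^bsub>X\<^esub> F i" if "i \<in> A" for i
    using FG[OF that] cov_eq_iff[OF X, of "F i" "G i"] by simp_all
  have "(\<Union>i\<in>A. F i) \<subseteq> carr X" "(\<Union>i\<in>A. G i) \<subseteq> carr X" using FG by blast+
  then show ?thesis
    unfolding cov_eq_iff[OF X \<open>(\<Union>i\<in>A. F i) \<subseteq> carr X\<close> \<open>(\<Union>i\<in>A. G i) \<subseteq> carr X\<close>]
    using FG FG' by (intro conjI *) auto
qed

lemma saturate_eq:
  assumes X: "basic_cover X" and U: "U \<subseteq> carr X"
  shows "saturate X U \<subseteq> carr X" "saturate X U \<approx>\<^bsub>X\<^esub> U"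
proof -
  show S: "saturate X U \<subseteq> carr X" by (auto simp: saturate_def)
  show "saturate X U \<approx>\<^bsub>X\<^esub> U"
    unfolding cov_eq_iff[OF X S U]
  proof
    show "saturate X U \<lhd>\<^bsub>X\<^esub> U" by (auto simp: saturate_def covered_def)
    show "U \<lhd>\<^bsub>X\<^esub> saturate X U"
      using covered_subset[OF X U order_refl] U
      by (intro covered_subset[OF X S]) (simp add: saturate_def covered_def subset_iff)
  qed
qed

lemma cover_with_opD:
  assumes "cover_with_op X"
  shows "basic_cover X" "U \<subseteq> carr X \<Longrightarrow> V \<subseteq> carr X \<Longrightarrow> U \<odot>\<^bsub>X\<^esub> V \<subseteq> carr X"
  using assms by (auto simp: cover_with_op_def PiE_def Pi_iff)


section \<open>Basic cover maps and their classes\<close>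

lemma preimage_elementwise: "r\<inverse> `` V = (\<Union>b\<in>V. r\<inverse> `` {b})"
  by blast

lemma preimage_in_carr: "basic_cover_map X Y r \<Longrightarrow> r\<inverse> `` V \<subseteq> carr X"
  unfolding basic_cover_map_def by blast

lemma basic_cover_map_covered:
  assumes "basic_cover_map X Y r" "U \<lhd>\<^bsub>Y\<^esub> V"
  shows "r\<inverse> `` U \<lhd>\<^bsub>X\<^esub> r\<inverse> `` V"
  unfolding preimage_elementwise[of r U] covered_UN
proof
  fix b assume "b \<in> U"
  with assms show "r\<inverse> `` {b} \<lhd>\<^bsub>X\<^esub> r\<inverse> `` V"
    unfolding basic_cover_map_def covered_def[of U] by blast
qed

lemma basic_cover_map_cov_eq:
  assumes "basic_cover X" "basic_cover Y" "basic_cover_map X Y r"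
    "U \<subseteq> carr Y" "V \<subseteq> carr Y" "U \<approx>\<^bsub>Y\<^esub> V"
  shows "r\<inverse> `` U \<approx>\<^bsub>X\<^esub> r\<inverse> `` V"
  using assms basic_cover_map_covered[OF assms(3)] preimage_in_carr[OF assms(3)]
  by (simp add: cov_eq_iff)

lemma basic_cover_map_coarser:
  assumes "basic_cover_map X Y r" "carr Y' = carr Y" "cov Y' \<subseteq> cov Y"
  shows "basic_cover_map X Y' r"
  using assms unfolding basic_cover_map_def by auto

lemma basic_cover_map_Id: "basic_cover X \<Longrightarrow> basic_cover_map X X (Id_on (carr X))"
  unfolding basic_cover_map_def
proof (intro conjI allI impI)
  fix b V assume X: "basic_cover X" and bV: "(b, V) \<in> cov X"
  then have "(Id_on (carr X))\<inverse> `` {b} = {b}" "(Id_on (carr X))\<inverse> `` V = V"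
    using cov_in_carr[OF X bV] by auto
  with bV show "(Id_on (carr X))\<inverse> `` {b} \<lhd>\<^bsub>X\<^esub> (Id_on (carr X))\<inverse> `` V" by (simp add: covered_def)
qed auto

lemma basic_cover_map_comp:
  assumes r: "basic_cover_map X Y r" and s: "basic_cover_map Y Z s"
  shows "basic_cover_map X Z (r O s)"
  unfolding basic_cover_map_def
proof (intro conjI allI impI)
  show "r O s \<subseteq> carr X \<times> carr Z" using r s by (auto simp: basic_cover_map_def)
  fix b V assume "(b, V) \<in> cov Z"
  then show "(r O s)\<inverse> `` {b} \<lhd>\<^bsub>X\<^esub> (r O s)\<inverse> `` V"
    using s unfolding converse_relcomp relcomp_Image
    by (intro basic_cover_map_covered[OF r]) (simp add: basic_cover_map_def)
qed

text \<open>Equality of maps is tested on points; it extends to subsets because saturation turns unions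
  into joins.\<close>

lemma map_eq_cov_eq:
  assumes X: "basic_cover X" and r: "basic_cover_map X Y r"
    and t: "t \<subseteq> carr X \<times> carr Y" and eq: "map_eq X Y r t" and V: "V \<subseteq> carr Y"
  shows "r\<inverse> `` V \<approx>\<^bsub>X\<^esub> t\<inverse> `` V"
  unfolding preimage_elementwise[of _ V]
  using eq V preimage_in_carr[OF r] t by (intro cov_eq_UN[OF X]) (auto simp: map_eq_def)

lemma basic_cover_map_transfer:
  assumes X: "basic_cover X" and Y: "basic_cover Y" and r: "basic_cover_map X Y r"
    and t: "t \<subseteq> carr X \<times> carr Y" and eq: "map_eq X Y r t"
  shows "basic_cover_map X Y t"
  unfolding basic_cover_map_def
proof (intro conjI allI impI t)
  fix b V assume bV: "(b, V) \<in> cov Y"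
  have V: "V \<subseteq> carr Y" and b: "{b} \<subseteq> carr Y" using cov_in_carr[OF Y bV] by auto
  have tS: "t\<inverse> `` U \<subseteq> carr X" for U using t by auto
  note rS = preimage_in_carr[OF r]
  have "t\<inverse> `` {b} \<lhd>\<^bsub>X\<^esub> r\<inverse> `` {b}"
    using map_eq_cov_eq[OF X r t eq b] by (simp only: cov_eq_iff[OF X rS tS])
  moreover have "r\<inverse> `` {b} \<lhd>\<^bsub>X\<^esub> r\<inverse> `` V" using r bV by (simp add: basic_cover_map_def)
  moreover have "r\<inverse> `` V \<lhd>\<^bsub>X\<^esub> t\<inverse> `` V"
    using map_eq_cov_eq[OF X r t eq V] by (simp only: cov_eq_iff[OF X rS tS])
  ultimately show "t\<inverse> `` {b} \<lhd>\<^bsub>X\<^esub> t\<inverse> `` V"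
    using covered_trans[OF X covered_trans[OF X _ _ rS] _ tS] by blast
qed

lemma map_class_eqI: "map_eq X Y r t \<Longrightarrow> map_class X Y r = map_class X Y t"
  by (auto simp: map_class_def map_eq_def cov_eq_def)

lemma map_class_self: "basic_cover_map X Y r \<Longrightarrow> r \<in> map_class X Y r"
  by (simp add: map_class_def map_eq_def cov_eq_def)

text \<open>A class may contain relations that do not preserve the operation up to \<open>\<approx>\<close>, as \<open>\<circ>\<close> need not
  respect \<open>\<approx>\<close>. Composition of classes is still well defined, because this uses the covers only.\<close>

lemma comp_class_map_class:
  assumes X: "basic_cover X" and Y: "basic_cover Y"
    and r: "basic_cover_map X Y r" and s: "basic_cover_map Y Z s"
  shows "comp_class X Y Z (map_class Y Z s) (map_class X Y r) = map_class X Z (r O s)"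
proof -
  have "map_class X Z (r' O s') = map_class X Z (r O s)"
    if r': "r' \<in> map_class X Y r" and s': "s' \<in> map_class Y Z s" for r' s'
  proof (rule map_class_eqI[symmetric])
    have r'': "basic_cover_map X Y r'" "map_eq X Y r r'" "r' \<subseteq> carr X \<times> carr Y"
      using r' by (auto simp: map_class_def basic_cover_map_def)
    have s'': "basic_cover_map Y Z s'" "map_eq Y Z s s'"
      using s' by (auto simp: map_class_def)
    show "map_eq X Z (r O s) (r' O s')"
      unfolding map_eq_def converse_relcomp relcomp_Image
    proof
      fix b assume b: "b \<in> carr Z"
      have "r\<inverse> `` (s\<inverse> `` {b}) \<approx>\<^bsub>X\<^esub> r'\<inverse> `` (s\<inverse> `` {b})"
        by (rule map_eq_cov_eq[OF X r r''(3,2) preimage_in_carr[OF s]])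
      also have "r'\<inverse> `` (s\<inverse> `` {b}) \<approx>\<^bsub>X\<^esub> r'\<inverse> `` (s'\<inverse> `` {b})"
        using s''(2) b
        by (intro basic_cover_map_cov_eq[OF X Y r''(1)] preimage_in_carr[OF s]
            preimage_in_carr[OF s''(1)]) (simp add: map_eq_def)
      finally show "r\<inverse> `` (s\<inverse> `` {b}) \<approx>\<^bsub>X\<^esub> r'\<inverse> `` (s'\<inverse> `` {b})" .
    qed
  qed
  then show ?thesis
    unfolding comp_class_def using map_class_self[OF r] map_class_self[OF s] by blast
qed


section \<open>The category of \<open>\<circ>\<close>-basic covers\<close>

lemma circ_basic_coverD:
  assumes "circ_basic_cover X"
  shows "basic_cover X"
    and "U \<subseteq> carr X \<Longrightarrow> V \<subseteq> carr X \<Longrightarrow> U \<odot>\<^bsub>X\<^esub> V \<subseteq> carr X"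
    and "\<U> \<subseteq> Pow (carr X) \<Longrightarrow> V \<subseteq> carr X \<Longrightarrow> (\<Union>U\<in>\<U>. U \<odot>\<^bsub>X\<^esub> V) \<approx>\<^bsub>X\<^esub> (\<Union>\<U>) \<odot>\<^bsub>X\<^esub> V"
    and "U \<subseteq> carr X \<Longrightarrow> V \<subseteq> carr X \<Longrightarrow> W \<subseteq> carr X \<Longrightarrow>
       (U \<odot>\<^bsub>X\<^esub> V) \<odot>\<^bsub>X\<^esub> W \<approx>\<^bsub>X\<^esub> U \<odot>\<^bsub>X\<^esub> (V \<odot>\<^bsub>X\<^esub> W)"
    and "U \<subseteq> carr X \<Longrightarrow> V \<subseteq> carr X \<Longrightarrow> U \<odot>\<^bsub>X\<^esub> V \<approx>\<^bsub>X\<^esub> V \<odot>\<^bsub>X\<^esub> U"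
    and "\<exists>E. circ_unit X E"
  using assms cover_with_opD[of X] by (simp_all add: circ_basic_cover_def)

lemma circ_cover_mapD:
  assumes "circ_cover_map X Y r"
  shows "basic_cover_map X Y r"
    and "U \<subseteq> carr Y \<Longrightarrow> V \<subseteq> carr Y \<Longrightarrow>
       r\<inverse> `` (U \<odot>\<^bsub>Y\<^esub> V) \<approx>\<^bsub>X\<^esub> (r\<inverse> `` U) \<odot>\<^bsub>X\<^esub> (r\<inverse> `` V)"
    and "circ_unit X E \<Longrightarrow> circ_unit Y E' \<Longrightarrow> r\<inverse> `` E' \<approx>\<^bsub>X\<^esub> E"
  using assms by (simp_all add: circ_cover_map_def)

lemma circ_unit_in_carr: "circ_unit X E \<Longrightarrow> E \<subseteq> carr X"
  by (simp add: circ_unit_def)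

lemma circ_cover_map_Id:
  assumes X: "circ_basic_cover X"
  shows "circ_cover_map X X (Id_on (carr X))"
  using basic_cover_map_Id[OF circ_basic_coverD(1)[OF X]] circ_basic_coverD(2)[OF X]
    circ_unit_unique[OF X]
  by (simp add: circ_cover_map_def Int_absorb1 cov_eq_refl circ_unit_in_carr)

text \<open>Although \<open>\<circ>\<close> may fail to respect \<open>\<approx>\<close>, maps compose: \<open>r\<^sup>-\<close> preserves \<open>\<approx>\<close>, and the condition
  of \<open>r\<close> on \<open>\<circ>\<close>, being imposed for all subsets, applies to the preimages under \<open>s\<close>.\<close>

lemma circ_cover_map_comp:
  assumes X: "circ_basic_cover X" and Y: "circ_basic_cover Y" and Z: "circ_basic_cover Z"
    and r: "circ_cover_map X Y r" and s: "circ_cover_map Y Z s"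
  shows "circ_cover_map X Z (r O s)"
  unfolding circ_cover_map_def converse_relcomp relcomp_Image
proof (intro conjI allI impI)
  note bX = circ_basic_coverD(1)[OF X] and bY = circ_basic_coverD(1)[OF Y]
    and rm = circ_cover_mapD(1)[OF r] and sm = circ_cover_mapD(1)[OF s]
  show "basic_cover_map X Z (r O s)" by (rule basic_cover_map_comp[OF rm sm])
  note sC = preimage_in_carr[OF sm]
  { fix U V assume UV: "U \<subseteq> carr Z \<and> V \<subseteq> carr Z"
    have "r\<inverse> `` (s\<inverse> `` (U \<odot>\<^bsub>Z\<^esub> V)) \<approx>\<^bsub>X\<^esub> r\<inverse> `` ((s\<inverse> `` U) \<odot>\<^bsub>Y\<^esub> (s\<inverse> `` V))"
      using UV by (intro basic_cover_map_cov_eq[OF bX bY rm] sC circ_cover_mapD(2)[OF s]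
          circ_basic_coverD(2)[OF Y]) auto
    also have "\<dots> \<approx>\<^bsub>X\<^esub> (r\<inverse> `` (s\<inverse> `` U)) \<odot>\<^bsub>X\<^esub> (r\<inverse> `` (s\<inverse> `` V))"
      by (intro circ_cover_mapD(2)[OF r] sC)
    finally show "r\<inverse> `` (s\<inverse> `` (U \<odot>\<^bsub>Z\<^esub> V)) \<approx>\<^bsub>X\<^esub> (r\<inverse> `` (s\<inverse> `` U)) \<odot>\<^bsub>X\<^esub> (r\<inverse> `` (s\<inverse> `` V))" . }
  fix E E' assume E: "circ_unit X E \<and> circ_unit Z E'"
  obtain E'' where E'': "circ_unit Y E''" using circ_basic_coverD(6)[OF Y] by blast
  have "r\<inverse> `` (s\<inverse> `` E') \<approx>\<^bsub>X\<^esub> r\<inverse> `` E''"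
    using E E'' by (intro basic_cover_map_cov_eq[OF bX bY rm] sC circ_cover_mapD(3)[OF s]
        circ_unit_in_carr) auto
  also have "r\<inverse> `` E'' \<approx>\<^bsub>X\<^esub> E" using E E'' by (intro circ_cover_mapD(3)[OF r]) auto
  finally show "r\<inverse> `` (s\<inverse> `` E') \<approx>\<^bsub>X\<^esub> E" .
qed

lemma is_category_BCov_circ_i: "is_category BCov_circ_i"
proof -
  have Id_l: "Id_on (carr X) O r = r" and Id_r: "r O Id_on (carr Y) = r"
    if "circ_cover_map X Y r" for X Y :: "'a ocover" and r
    using circ_cover_mapD(1)[OF that] by (auto simp: basic_cover_map_def)
  show ?thesis
    unfolding is_category_def BCov_circ_i_def
    by (auto simp: comp_class_map_class circ_basic_coverD(1) circ_cover_mapD(1)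
        circ_cover_map_Id circ_cover_map_comp Id_l Id_r O_assoc intro!: imageI)
qed


section \<open>Inductively generated convergent covers\<close>

locale convergent_generators =
  fixes S :: "'a set" and I :: "'a \<Rightarrow> 'i set" and C :: "'a \<Rightarrow> 'i \<Rightarrow> 'a set"
    and \<delta> :: "'a \<Rightarrow> 'a \<Rightarrow> 'a set"
  assumes axioms: "axiom_set S I C"
    and closed: "a \<in> S \<Longrightarrow> b \<in> S \<Longrightarrow> \<delta> a b \<subseteq> S"
begin

abbreviation X :: "'a ocover" where "X \<equiv> conv_ocover S I C \<delta>"

lemma carr_X [simp]: "carr X = S"
  by (simp add: conv_ocover_def)

lemma basic_X: "basic_cover X"
  by (simp add: conv_ocover_def gen_cover_basic)

lemma op_of_closed: "U \<subseteq> S \<Longrightarrow> V \<subseteq> S \<Longrightarrow> op_of \<delta> U V \<subseteq> S"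
  using closed unfolding op_of_def by blast

lemma op_X: "U \<subseteq> S \<Longrightarrow> V \<subseteq> S \<Longrightarrow> U \<odot>\<^bsub>X\<^esub> V = op_of \<delta> U V"
  by (simp add: conv_ocover_def)

lemma axiom_set_D: "axiom_set S (J_set S I \<delta>) (D_sub C \<delta>)"
  unfolding axiom_set_def
proof (intro ballI)
  fix a j assume a: "a \<in> S" and j: "j \<in> J_set S I \<delta> a"
  show "D_sub C \<delta> a j \<subseteq> S"
  proof (cases j)
    case (Given i)
    with a j axioms show ?thesis unfolding J_set_def axiom_set_def by auto
  next
    case (Comm b c)
    with j closed show ?thesis by (simp add: J_set_def image_iff)
  next
    case (Assoc b c d)
    with j have "{b} \<subseteq> S" "\<delta> c d \<subseteq> S" using closed by (simp_all add: J_set_def image_iff)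
    with Assoc op_of_closed show ?thesis by simp
  qed
qed

lemma axiom_set_stab: "axiom_set S (stab_set S (J_set S I \<delta>) \<delta>) (stab_sub (D_sub C \<delta>) \<delta>)"
  unfolding axiom_set_def
proof (intro ballI)
  fix a k assume a: "a \<in> S" and k: "k \<in> stab_set S (J_set S I \<delta>) \<delta> a"
  show "stab_sub (D_sub C \<delta>) \<delta> a k \<subseteq> S"
  proof (cases k)
    case (Plain j)
    with a k axiom_set_D show ?thesis unfolding stab_set_def axiom_set_def by auto
  next
    case (Stab b c j)
    with k axiom_set_D have "D_sub C \<delta> b j \<subseteq> S" "{c} \<subseteq> S"
      unfolding stab_set_def axiom_set_def by auto
    with Stab op_of_closed show ?thesis by simp
  qed
qed

lemma cov_axiom:
  assumes "a \<in> S" "j \<in> J_set S I \<delta> a"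
  shows "(a, D_sub C \<delta> a j) \<in> cov X"
  using gen_cover_axiom[OF axiom_set_stab assms(1), of "Plain j"] assms(2)
  by (auto simp: conv_ocover_def stab_set_def)

lemma cov_stab_axiom:
  assumes "b \<in> S" "c \<in> S" "j \<in> J_set S I \<delta> b"
  shows "op_of \<delta> {b} {c} \<lhd>\<^bsub>X\<^esub> op_of \<delta> (D_sub C \<delta> b j) {c}"
  unfolding covered_def
proof
  fix a assume a: "a \<in> op_of \<delta> {b} {c}"
  then have "a \<in> S" using op_of_closed[of "{b}" "{c}"] assms by auto
  with a show "(a, op_of \<delta> (D_sub C \<delta> b j) {c}) \<in> cov X"
    using gen_cover_axiom[OF axiom_set_stab, of a "Stab b c j"] assms
    by (auto simp: conv_ocover_def stab_set_def op_of_def)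
qed

lemma covered_op_ofI:
  assumes "\<And>a b. a \<in> U \<Longrightarrow> b \<in> V \<Longrightarrow> op_of \<delta> {a} {b} \<lhd>\<^bsub>X\<^esub> W"
  shows "op_of \<delta> U V \<lhd>\<^bsub>X\<^esub> W"
  using assms by (fastforce simp: op_of_def covered_def)

lemma op_of_mono: "U \<subseteq> U' \<Longrightarrow> V \<subseteq> V' \<Longrightarrow> op_of \<delta> U V \<subseteq> op_of \<delta> U' V'"
  unfolding op_of_def by blast

lemma op_of_Union: "op_of \<delta> (\<Union>\<U>) V = (\<Union>U\<in>\<U>. op_of \<delta> U V)"
  and op_of_Union': "op_of \<delta> V (\<Union>\<U>) = (\<Union>U\<in>\<U>. op_of \<delta> V U)"
  unfolding op_of_def by blast+

lemma op_of_commute: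
  assumes U: "U \<subseteq> S" and V: "V \<subseteq> S"
  shows "op_of \<delta> U V \<lhd>\<^bsub>X\<^esub> op_of \<delta> V U"
  unfolding covered_def
proof
  fix x assume "x \<in> op_of \<delta> U V"
  then obtain a b where ab: "a \<in> U" "b \<in> V" "x \<in> \<delta> a b" by (auto simp: op_of_def)
  with U V closed have "a \<in> S" "b \<in> S" "x \<in> S" by blast+
  with ab cov_axiom[of x "Comm a b"] have "{x} \<lhd>\<^bsub>X\<^esub> \<delta> b a" by (auto simp: J_set_def covered_def)
  moreover have "\<delta> b a \<subseteq> op_of \<delta> V U" using ab by (auto simp: op_of_def)
  ultimately show "(x, op_of \<delta> V U) \<in> cov X"
    using covered_trans[OF basic_X] covered_subset[OF basic_X, unfolded carr_X] op_of_closed[OF V U]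
    by (metis carr_X covered_def singletonI)
qed

lemma op_of_assoc:
  assumes U: "U \<subseteq> S" and V: "V \<subseteq> S" and W: "W \<subseteq> S"
  shows "op_of \<delta> (op_of \<delta> U V) W \<lhd>\<^bsub>X\<^esub> op_of \<delta> U (op_of \<delta> V W)"
  unfolding covered_def
proof
  fix x assume x: "x \<in> op_of \<delta> (op_of \<delta> U V) W"
  then obtain a b c where abc: "a \<in> U" "b \<in> V" "c \<in> W" "x \<in> op_of \<delta> (\<delta> a b) {c}"
    by (auto simp: op_of_def)
  have "x \<in> S" using x op_of_closed[OF op_of_closed[OF U V] W] by blast
  with abc U V W cov_axiom[of x "Assoc a b c"] have "{x} \<lhd>\<^bsub>X\<^esub> op_of \<delta> {a} (\<delta> b c)"
    by (auto simp: J_set_def covered_def)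
  moreover have "op_of \<delta> {a} (\<delta> b c) \<subseteq> op_of \<delta> U (op_of \<delta> V W)"
    using abc by (auto simp: op_of_def)
  ultimately show "(x, op_of \<delta> U (op_of \<delta> V W)) \<in> cov X"
    using covered_trans[OF basic_X] covered_subset[OF basic_X, unfolded carr_X]
      op_of_closed[OF U op_of_closed[OF V W]]
    by (metis carr_X covered_def singletonI)
qed

text \<open>Only one half of associativity is an axiom; the other half follows by rotating the three
  factors with commutativity.\<close>

lemma op_of_assoc':
  assumes U: "U \<subseteq> S" and V: "V \<subseteq> S" and W: "W \<subseteq> S"
  shows "op_of \<delta> U (op_of \<delta> V W) \<lhd>\<^bsub>X\<^esub> op_of \<delta> (op_of \<delta> U V) W"
proof -
  note c = op_of_closed and tr = covered_trans[OF basic_X, unfolded carr_X]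
  have 1: "op_of \<delta> U (op_of \<delta> V W) \<lhd>\<^bsub>X\<^esub> op_of \<delta> V (op_of \<delta> W U)"
    by (rule tr[OF op_of_commute op_of_assoc]) (intro c U V W)+
  have 2: "op_of \<delta> V (op_of \<delta> W U) \<lhd>\<^bsub>X\<^esub> op_of \<delta> W (op_of \<delta> U V)"
    by (rule tr[OF op_of_commute op_of_assoc]) (intro c U V W)+
  have 3: "op_of \<delta> W (op_of \<delta> U V) \<lhd>\<^bsub>X\<^esub> op_of \<delta> (op_of \<delta> U V) W"
    by (rule op_of_commute) (intro c U V W)+
  show ?thesis
    by (rule tr[OF tr[OF 1 2] 3]) (intro c U V W)+
qed

text \<open>The generators contain stability for the axioms of \<open>J\<close> only, multiplied once by a point. The
  stability axioms themselves need not be multiplied again: by associativity, multiplying by \<open>d\<close> and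
  then by \<open>c\<close> amounts to multiplying by the points of \<open>d \<circ> c\<close>.\<close>

lemma localization:
  assumes "(b, V) \<in> cov X" "c \<in> S"
  shows "op_of \<delta> {b} {c} \<lhd>\<^bsub>X\<^esub> op_of \<delta> V {c}"
proof -
  note tr = covered_trans[OF basic_X, unfolded carr_X]
  note sub = covered_subset[OF basic_X, unfolded carr_X]
  have "(b, V) \<in> gen_cover S (stab_set S (J_set S I \<delta>) \<delta>) (stab_sub (D_sub C \<delta>) \<delta>)"
    using assms(1) by (simp add: conv_ocover_def)
  then show ?thesis
    using assms(2)
  proof (induction arbitrary: c rule: gen_cover.induct)
    case (refl U a)
    then show ?case by (intro sub op_of_closed op_of_mono) auto
  next
    case (infer U a k)
    have aS: "a \<in> S" and US: "U \<subseteq> S" and cS: "c \<in> S" by fact+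
    have Uc: "op_of \<delta> U {c} \<subseteq> S" using US cS by (intro op_of_closed) auto
    have step: "op_of \<delta> (stab_sub (D_sub C \<delta>) \<delta> a k) {c} \<lhd>\<^bsub>X\<^esub> op_of \<delta> U {c}"
      by (rule covered_op_ofI) (use infer.IH[OF _ cS] in auto)
    have "op_of \<delta> {a} {c} \<lhd>\<^bsub>X\<^esub> op_of \<delta> (stab_sub (D_sub C \<delta>) \<delta> a k) {c}"
    proof (cases k)
      case (Plain j)
      then have "j \<in> J_set S I \<delta> a" using infer.hyps by (auto simp: stab_set_def)
      with Plain cov_stab_axiom[OF aS cS] show ?thesis by simp
    next
      case (Stab b d j)
      then have b: "b \<in> S" and d: "d \<in> S" and a: "a \<in> \<delta> b d" and j: "j \<in> J_set S I \<delta> b"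
        using infer.hyps by (auto simp: stab_set_def)
      let ?D = "D_sub C \<delta> b j"
      have D: "?D \<subseteq> S" using axiom_set_D b j by (auto simp: axiom_set_def)
      have s: "{b} \<subseteq> S" "{c} \<subseteq> S" "{d} \<subseteq> S" using b cS d by auto
      note cl = op_of_closed s D
      \<comment> \<open>\<open>a \<circ> c \<lhd> (b \<circ> d) \<circ> c \<lhd> b \<circ> (d \<circ> c) \<lhd> D \<circ> (d \<circ> c) \<lhd> (D \<circ> d) \<circ> c\<close>\<close>
      have 1: "op_of \<delta> {a} {c} \<lhd>\<^bsub>X\<^esub> op_of \<delta> (op_of \<delta> {b} {d}) {c}"
        using a by (intro sub cl op_of_mono) (auto simp: op_of_def)
      have 2: "op_of \<delta> (op_of \<delta> {b} {d}) {c} \<lhd>\<^bsub>X\<^esub> op_of \<delta> {b} (op_of \<delta> {d} {c})"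
        by (intro op_of_assoc s)
      have 3: "op_of \<delta> {b} (op_of \<delta> {d} {c}) \<lhd>\<^bsub>X\<^esub> op_of \<delta> ?D (op_of \<delta> {d} {c})"
      proof (rule covered_op_ofI)
        fix b' e assume "b' \<in> {b}" and e: "e \<in> op_of \<delta> {d} {c}"
        then have "b' = b" "e \<in> S" using op_of_closed[OF s(3,2)] by auto
        then have "op_of \<delta> {b'} {e} \<lhd>\<^bsub>X\<^esub> op_of \<delta> ?D {e}" using cov_stab_axiom[OF b _ j] by simp
        moreover have "op_of \<delta> ?D {e} \<lhd>\<^bsub>X\<^esub> op_of \<delta> ?D (op_of \<delta> {d} {c})"
          using e by (intro sub cl op_of_mono) auto
        ultimately show "op_of \<delta> {b'} {e} \<lhd>\<^bsub>X\<^esub> op_of \<delta> ?D (op_of \<delta> {d} {c})"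
          by (rule tr) (intro cl)
      qed
      have 4: "op_of \<delta> ?D (op_of \<delta> {d} {c}) \<lhd>\<^bsub>X\<^esub> op_of \<delta> (op_of \<delta> ?D {d}) {c}"
        by (intro op_of_assoc' s D)
      show ?thesis unfolding Stab stab_sub.simps
        by (rule tr[OF tr[OF tr[OF 1 2] 3] 4]) (intro cl)+
    qed
    from this step Uc show ?case by (rule tr)
  qed
qed

lemma op_of_covered:
  assumes U: "U \<subseteq> S" "U' \<subseteq> S" and V: "V \<subseteq> S" "V' \<subseteq> S"
    and UV: "U \<lhd>\<^bsub>X\<^esub> V" and UV': "U' \<lhd>\<^bsub>X\<^esub> V'"
  shows "op_of \<delta> U U' \<lhd>\<^bsub>X\<^esub> op_of \<delta> V V'"
proof -
  note tr = covered_trans[OF basic_X, unfolded carr_X]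
  note sub = covered_subset[OF basic_X, unfolded carr_X]
  have left: "op_of \<delta> P R \<lhd>\<^bsub>X\<^esub> op_of \<delta> Q R"
    if "Q \<subseteq> S" "R \<subseteq> S" "P \<lhd>\<^bsub>X\<^esub> Q" for P Q R
  proof (rule covered_op_ofI)
    fix b c assume "b \<in> P" "c \<in> R"
    with that have "op_of \<delta> {b} {c} \<lhd>\<^bsub>X\<^esub> op_of \<delta> Q {c}"
      by (intro localization) (auto simp: covered_def)
    moreover have "op_of \<delta> Q {c} \<lhd>\<^bsub>X\<^esub> op_of \<delta> Q R"
      using that \<open>c \<in> R\<close> by (intro sub op_of_closed op_of_mono) auto
    ultimately show "op_of \<delta> {b} {c} \<lhd>\<^bsub>X\<^esub> op_of \<delta> Q R"
      using op_of_closed[OF that(1,2)] by (rule tr)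
  qed
  have 1: "op_of \<delta> U U' \<lhd>\<^bsub>X\<^esub> op_of \<delta> V U'" by (rule left) fact+
  have 2: "op_of \<delta> V U' \<lhd>\<^bsub>X\<^esub> op_of \<delta> U' V" by (rule op_of_commute) fact+
  have 3: "op_of \<delta> U' V \<lhd>\<^bsub>X\<^esub> op_of \<delta> V' V" by (rule left) fact+
  have 4: "op_of \<delta> V' V \<lhd>\<^bsub>X\<^esub> op_of \<delta> V V'" by (rule op_of_commute) fact+
  show ?thesis by (rule tr[OF tr[OF tr[OF 1 2] 3] 4]) (intro op_of_closed U V)+
qed

lemma op_of_cov_eq:
  assumes "U \<subseteq> S" "U' \<subseteq> S" "V \<subseteq> S" "V' \<subseteq> S" "U \<approx>\<^bsub>X\<^esub> V" "U' \<approx>\<^bsub>X\<^esub> V'"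
  shows "op_of \<delta> U U' \<approx>\<^bsub>X\<^esub> op_of \<delta> V V'"
  using assms op_of_covered op_of_closed cov_eq_iff[OF basic_X] by simp

lemma cover_with_op_X: "cover_with_op X"
  unfolding cover_with_op_def
proof
  show "oper X \<in> Pow (carr X) \<times> Pow (carr X) \<rightarrow>\<^sub>E Pow (carr X)"
    using op_of_closed by (auto simp: conv_ocover_def)
qed (rule basic_X)

lemma sat_op_join:
  assumes \<U>: "\<U> \<subseteq> Sat X" and Q: "Q \<in> Sat X"
  shows "sat_op X (sat_join X \<U>) Q = sat_join X ((\<lambda>P. sat_op X P Q) ` \<U>)"
    and "sat_op X Q (sat_join X \<U>) = sat_join X ((\<lambda>P. sat_op X Q P) ` \<U>)"
proof -
  have QS: "Q \<subseteq> S" and PS: "\<And>P. P \<in> \<U> \<Longrightarrow> P \<subseteq> S" and US: "\<Union>\<U> \<subseteq> S"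
    using \<U> Q by (auto simp: Sat_def)
  note sat = saturate_eq[OF basic_X, unfolded carr_X]
  \<comment> \<open>Both laws compare a product of saturated sets \<open>A\<close>, \<open>B\<close> with the product of the unsaturated
    unions \<open>A'\<close>, \<open>B'\<close>, which distributes strictly.\<close>
  have eq: "saturate X (op_of \<delta> A B) = sat_join X (F ` \<U>)"
    if "A \<subseteq> S" "B \<subseteq> S" "A \<approx>\<^bsub>X\<^esub> A'" "B \<approx>\<^bsub>X\<^esub> B'" "A' \<subseteq> S" "B' \<subseteq> S"
      "op_of \<delta> A' B' = (\<Union>P\<in>\<U>. G P)" "\<And>P. P \<in> \<U> \<Longrightarrow> F P = saturate X (G P) \<and> G P \<subseteq> S"
    for A B A' B' F G
  proof -
    have "op_of \<delta> A B \<approx>\<^bsub>X\<^esub> op_of \<delta> A' B'" by (rule op_of_cov_eq) fact+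
    also have "\<dots> \<approx>\<^bsub>X\<^esub> (\<Union>P\<in>\<U>. F P)"
      unfolding that(7) using that(8) sat by (intro cov_eq_UN[OF basic_X]) (auto intro: cov_eq_sym)
    finally show ?thesis by (simp add: cov_eq_def sat_join_def)
  qed
  note J = sat[OF US]
  have "sat_op X (sat_join X \<U>) Q = saturate X (op_of \<delta> (sat_join X \<U>) Q)"
    using J QS by (simp add: sat_op_def sat_join_def op_X)
  also have "\<dots> = sat_join X ((\<lambda>P. sat_op X P Q) ` \<U>)"
    using J QS US PS
    by (intro eq[of _ _ "\<Union>\<U>" Q "\<lambda>P. op_of \<delta> P Q"])
      (simp_all add: sat_join_def cov_eq_refl sat_op_def op_X op_of_closed op_of_Union op_of_Union')
  finally show "sat_op X (sat_join X \<U>) Q = sat_join X ((\<lambda>P. sat_op X P Q) ` \<U>)" .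
  have "sat_op X Q (sat_join X \<U>) = saturate X (op_of \<delta> Q (sat_join X \<U>))"
    using J QS by (simp add: sat_op_def sat_join_def op_X)
  also have "\<dots> = sat_join X ((\<lambda>P. sat_op X Q P) ` \<U>)"
    using J QS US PS
    by (intro eq[of _ _ Q "\<Union>\<U>" "\<lambda>P. op_of \<delta> Q P"])
      (simp_all add: sat_join_def cov_eq_refl sat_op_def op_X op_of_closed op_of_Union op_of_Union')
  finally show "sat_op X Q (sat_join X \<U>) = sat_join X ((\<lambda>P. sat_op X Q P) ` \<U>)" .
qed

lemma convergent_X: "convergent_cover X"
  unfolding convergent_cover_def
  using cover_with_op_X op_of_covered op_of_assoc op_of_commute sat_op_join
  by (simp add: op_X op_of_closed)

end

lemma ind_gen_convergent_op:
  assumes X: "ind_gen_convergent X" and U: "U \<subseteq> carr X" and V: "V \<subseteq> carr X"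
  shows "U \<odot>\<^bsub>X\<^esub> V = (\<Union>a\<in>U. \<Union>b\<in>V. {a} \<odot>\<^bsub>X\<^esub> {b})"
proof -
  obtain I :: "'a \<Rightarrow> 'a set set" and C \<delta> where Xe: "X = conv_ocover (carr X) I C \<delta>"
    using X by (auto simp: ind_gen_convergent_def)
  have *: "A \<odot>\<^bsub>X\<^esub> B = op_of \<delta> A B" if "A \<subseteq> carr X" "B \<subseteq> carr X" for A B
    using that by (subst Xe) (simp add: conv_ocover_def)
  have "{a} \<odot>\<^bsub>X\<^esub> {b} = \<delta> a b" if "a \<in> U" "b \<in> V" for a b
    using that U V *[of "{a}" "{b}"] by (auto simp: op_of_def)
  then show ?thesis using *[OF U V] by (simp add: op_of_def)
qed


section \<open>Unital convergent covers form a full subcategory\<close>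

lemma convergent_coverD:
  assumes "convergent_cover X"
  shows "basic_cover X"
    and "U \<subseteq> carr X \<Longrightarrow> V \<subseteq> carr X \<Longrightarrow> U \<odot>\<^bsub>X\<^esub> V \<subseteq> carr X"
    and "U \<subseteq> carr X \<Longrightarrow> U' \<subseteq> carr X \<Longrightarrow> V \<subseteq> carr X \<Longrightarrow> V' \<subseteq> carr X \<Longrightarrow>
      U \<lhd>\<^bsub>X\<^esub> V \<Longrightarrow> U' \<lhd>\<^bsub>X\<^esub> V' \<Longrightarrow> U \<odot>\<^bsub>X\<^esub> U' \<lhd>\<^bsub>X\<^esub> V \<odot>\<^bsub>X\<^esub> V'"
    and "U \<subseteq> carr X \<Longrightarrow> V \<subseteq> carr X \<Longrightarrow> U \<odot>\<^bsub>X\<^esub> V \<approx>\<^bsub>X\<^esub> V \<odot>\<^bsub>X\<^esub> U"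
    and "U \<subseteq> carr X \<Longrightarrow> V \<subseteq> carr X \<Longrightarrow> W \<subseteq> carr X \<Longrightarrow>
      (U \<odot>\<^bsub>X\<^esub> V) \<odot>\<^bsub>X\<^esub> W \<approx>\<^bsub>X\<^esub> U \<odot>\<^bsub>X\<^esub> (V \<odot>\<^bsub>X\<^esub> W)"
proof -
  have c: "cover_with_op X" using assms by (simp add: convergent_cover_def)
  show b: "basic_cover X" using cover_with_opD(1)[OF c] .
  have cl: "U \<odot>\<^bsub>X\<^esub> V \<subseteq> carr X" if "U \<subseteq> carr X" "V \<subseteq> carr X" for U V
    using cover_with_opD(2)[OF c that] .
  then show "U \<subseteq> carr X \<Longrightarrow> V \<subseteq> carr X \<Longrightarrow> U \<odot>\<^bsub>X\<^esub> V \<subseteq> carr X" .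
  show "U \<subseteq> carr X \<Longrightarrow> U' \<subseteq> carr X \<Longrightarrow> V \<subseteq> carr X \<Longrightarrow> V' \<subseteq> carr X \<Longrightarrow>
      U \<lhd>\<^bsub>X\<^esub> V \<Longrightarrow> U' \<lhd>\<^bsub>X\<^esub> V' \<Longrightarrow> U \<odot>\<^bsub>X\<^esub> U' \<lhd>\<^bsub>X\<^esub> V \<odot>\<^bsub>X\<^esub> V'"
    by (rule assms[unfolded convergent_cover_def, THEN conjunct2, THEN conjunct1, rule_format]) simp
  have comm: "U \<odot>\<^bsub>X\<^esub> V \<lhd>\<^bsub>X\<^esub> V \<odot>\<^bsub>X\<^esub> U" if "U \<subseteq> carr X" "V \<subseteq> carr X" for U V
    using assms[unfolded convergent_cover_def, THEN conjunct2, THEN conjunct2, THEN conjunct2, THEN conjunct1] that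
    by simp
  then show "U \<subseteq> carr X \<Longrightarrow> V \<subseteq> carr X \<Longrightarrow> U \<odot>\<^bsub>X\<^esub> V \<approx>\<^bsub>X\<^esub> V \<odot>\<^bsub>X\<^esub> U"
    by (simp add: cov_eq_iff b cl)
  have assoc: "(U \<odot>\<^bsub>X\<^esub> V) \<odot>\<^bsub>X\<^esub> W \<lhd>\<^bsub>X\<^esub> U \<odot>\<^bsub>X\<^esub> (V \<odot>\<^bsub>X\<^esub> W)"
    if "U \<subseteq> carr X" "V \<subseteq> carr X" "W \<subseteq> carr X" for U V W
    using assms[unfolded convergent_cover_def, THEN conjunct2, THEN conjunct2, THEN conjunct1] that
    by simp
  assume U: "U \<subseteq> carr X" and V: "V \<subseteq> carr X" and W: "W \<subseteq> carr X"
  have rotate: "P \<odot>\<^bsub>X\<^esub> (Q \<odot>\<^bsub>X\<^esub> R) \<lhd>\<^bsub>X\<^esub> Q \<odot>\<^bsub>X\<^esub> (R \<odot>\<^bsub>X\<^esub> P)"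
    if "P \<subseteq> carr X" "Q \<subseteq> carr X" "R \<subseteq> carr X" for P Q R
    using that by (intro covered_trans[OF b comm assoc] cl)
  have "U \<odot>\<^bsub>X\<^esub> (V \<odot>\<^bsub>X\<^esub> W) \<lhd>\<^bsub>X\<^esub> (U \<odot>\<^bsub>X\<^esub> V) \<odot>\<^bsub>X\<^esub> W"
    by (rule covered_trans[OF b covered_trans[OF b rotate rotate] comm]) (intro cl U V W)+
  then show "(U \<odot>\<^bsub>X\<^esub> V) \<odot>\<^bsub>X\<^esub> W \<approx>\<^bsub>X\<^esub> U \<odot>\<^bsub>X\<^esub> (V \<odot>\<^bsub>X\<^esub> W)"
    using assoc[OF U V W] U V W by (simp add: cov_eq_iff b cl)
qed

lemma conv_unit_iff_circ_unit:
  assumes "convergent_cover X"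
  shows "conv_unit X E \<longleftrightarrow> circ_unit X E"
  unfolding conv_unit_def circ_unit_def
  using convergent_coverD(4)[OF assms, of "{_}" E] by (auto simp: cov_eq_def)

lemma unital_convergent_circ_basic:
  assumes X: "unital_convergent_cover X" and g: "ind_gen_convergent X"
  shows "circ_basic_cover X"
proof -
  have c: "convergent_cover X" using X by (simp add: unital_convergent_cover_def)
  have "(\<Union>U\<in>\<U>. U \<odot>\<^bsub>X\<^esub> V) = (\<Union>\<U>) \<odot>\<^bsub>X\<^esub> V" if "\<U> \<subseteq> Pow (carr X)" "V \<subseteq> carr X" for \<U> V
  proof -
    have "(\<Union>U\<in>\<U>. U \<odot>\<^bsub>X\<^esub> V) = (\<Union>U\<in>\<U>. \<Union>a\<in>U. \<Union>b\<in>V. {a} \<odot>\<^bsub>X\<^esub> {b})"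
      using that by (intro SUP_cong ind_gen_convergent_op[OF g]) auto
    also have "\<dots> = (\<Union>\<U>) \<odot>\<^bsub>X\<^esub> V"
      using that by (subst ind_gen_convergent_op[OF g]) auto
    finally show ?thesis .
  qed
  then show ?thesis
    using X convergent_coverD(4,5)[OF c] conv_unit_iff_circ_unit[OF c]
    by (simp add: circ_basic_cover_def unital_convergent_cover_def convergent_cover_def cov_eq_refl)
qed

text \<open>With all subsets that cover \<open>a\<close> as the axioms for \<open>a\<close>, every basic cover is inductively
  generated, impredicatively. This gives a uniform axiom-set for the coreflection, without choosing
  one for each object.\<close>

lemma basic_cover_generates_itself:
  assumes X: "basic_cover X"
  shows "axiom_set (carr X) (\<lambda>a. {U. (a, U) \<in> cov X}) (\<lambda>a U. U)"
    and "gen_cover (carr X) (\<lambda>a. {U. (a, U) \<in> cov X}) (\<lambda>a U. U) = cov X"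
proof -
  show ax: "axiom_set (carr X) (\<lambda>a. {U. (a, U) \<in> cov X}) (\<lambda>a U. U)"
    using cov_in_carr[OF X] by (auto simp: axiom_set_def)
  show "gen_cover (carr X) (\<lambda>a. {U. (a, U) \<in> cov X}) (\<lambda>a U. U) = cov X"
  proof (rule subset_antisym)
    show "gen_cover (carr X) (\<lambda>a. {U. (a, U) \<in> cov X}) (\<lambda>a U. U) \<subseteq> cov X"
      by (rule gen_cover_least[OF X]) simp
    show "cov X \<subseteq> gen_cover (carr X) (\<lambda>a. {U. (a, U) \<in> cov X}) (\<lambda>a U. U)"
      using gen_cover_axiom[OF ax] cov_in_carr[OF X] by auto
  qed
qed

text \<open>The heart of the full inclusion: in both covers the operation is the union of its values on
  pairs of points, so the condition on points extends to subsets.\<close>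

lemma unital_convergent_cover_map_iff:
  assumes X: "unital_convergent_cover X" "ind_gen_convergent X"
    and Y: "unital_convergent_cover Y" "ind_gen_convergent Y"
  shows "unital_convergent_cover_map X Y r \<longleftrightarrow> circ_cover_map X Y r"
proof -
  have cX: "convergent_cover X" and cY: "convergent_cover Y"
    using X Y by (auto simp: unital_convergent_cover_def)
  have "r\<inverse> `` (U \<odot>\<^bsub>Y\<^esub> V) \<approx>\<^bsub>X\<^esub> (r\<inverse> `` U) \<odot>\<^bsub>X\<^esub> (r\<inverse> `` V)"
    if r: "basic_cover_map X Y r" and UV: "U \<subseteq> carr Y" "V \<subseteq> carr Y"
      and el: "\<forall>b1\<in>carr Y. \<forall>b2\<in>carr Y.
        r\<inverse> `` ({b1} \<odot>\<^bsub>Y\<^esub> {b2}) \<approx>\<^bsub>X\<^esub> (r\<inverse> `` {b1}) \<odot>\<^bsub>X\<^esub> (r\<inverse> `` {b2})" for U V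
  proof -
    note rC = preimage_in_carr[OF r]
    have "r\<inverse> `` (U \<odot>\<^bsub>Y\<^esub> V) = (\<Union>a\<in>U. \<Union>b\<in>V. r\<inverse> `` ({a} \<odot>\<^bsub>Y\<^esub> {b}))"
      by (simp add: ind_gen_convergent_op[OF Y(2) UV] Image_UN)
    also have "\<dots> \<approx>\<^bsub>X\<^esub> (\<Union>a\<in>U. \<Union>b\<in>V. (r\<inverse> `` {a}) \<odot>\<^bsub>X\<^esub> (r\<inverse> `` {b}))"
      by (intro cov_eq_UN[OF convergent_coverD(1)[OF cX]] conjI UN_least rC
          convergent_coverD(2)[OF cX]) (use el UV in auto)
    also have "\<dots> = (r\<inverse> `` U) \<odot>\<^bsub>X\<^esub> (r\<inverse> `` V)"
    proof -
      have "(r\<inverse> `` {a}) \<odot>\<^bsub>X\<^esub> (r\<inverse> `` {b}) =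
          (\<Union>x\<in>r\<inverse> `` {a}. \<Union>y\<in>r\<inverse> `` {b}. {x} \<odot>\<^bsub>X\<^esub> {y})" for a b
        by (rule ind_gen_convergent_op[OF X(2) rC rC])
      then show ?thesis
        unfolding ind_gen_convergent_op[OF X(2) rC rC] by blast
    qed
    finally show ?thesis .
  qed
  then show ?thesis
    unfolding unital_convergent_cover_map_def circ_cover_map_def
      conv_unit_iff_circ_unit[OF cX] conv_unit_iff_circ_unit[OF cY]
    by auto
qed


section \<open>The coreflection\<close>

definition convergent_coreflection :: "'a ocover \<Rightarrow> 'a ocover" where
  "convergent_coreflection Y =
     conv_ocover (carr Y) (\<lambda>a. {U. (a, U) \<in> cov Y}) (\<lambda>a U. U) (\<lambda>a b. {a} \<odot>\<^bsub>Y\<^esub> {b})"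

lemma carr_coreflection [simp]: "carr (convergent_coreflection Y) = carr Y"
  by (simp add: convergent_coreflection_def conv_ocover_def)

lemma coreflection_generators:
  assumes Y: "cover_with_op Y"
  shows "convergent_generators (carr Y) (\<lambda>a. {U. (a, U) \<in> cov Y}) (\<lambda>a U. U) (\<lambda>a b. {a} \<odot>\<^bsub>Y\<^esub> {b})"
  by standard (use basic_cover_generates_itself(1) cover_with_opD[OF Y] in simp_all)

lemma cov_coreflection:
  assumes Y: "cover_with_op Y"
  shows "cov Y \<subseteq> cov (convergent_coreflection Y)"
proof -
  interpret convergent_generators "carr Y" "\<lambda>a. {U. (a, U) \<in> cov Y}" "\<lambda>a U. U"
    "\<lambda>a b. {a} \<odot>\<^bsub>Y\<^esub> {b}" by (rule coreflection_generators[OF Y])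
  show ?thesis
  proof
    fix p assume p: "p \<in> cov Y"
    obtain a U where [simp]: "p = (a, U)" by (cases p)
    show "p \<in> cov (convergent_coreflection Y)"
      using cov_axiom[of a "Given U"] p cov_in_carr[OF cover_with_opD(1)[OF Y], of a U]
      by (simp add: J_set_def convergent_coreflection_def)
  qed
qed

lemma op_coreflection:
  "U \<subseteq> carr Y \<Longrightarrow> V \<subseteq> carr Y \<Longrightarrow>
    U \<odot>\<^bsub>convergent_coreflection Y\<^esub> V = (\<Union>a\<in>U. \<Union>b\<in>V. {a} \<odot>\<^bsub>Y\<^esub> {b})"
  by (simp add: convergent_coreflection_def conv_ocover_def op_of_def)

text \<open>Distributivity is assumed in the left argument only; commutativity transports it to the
  right one.\<close>

lemma circ_op_elementwise:
  assumes Y: "circ_basic_cover Y" and U: "U \<subseteq> carr Y" and V: "V \<subseteq> carr Y"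
  shows "U \<odot>\<^bsub>Y\<^esub> V \<approx>\<^bsub>Y\<^esub> (\<Union>a\<in>U. \<Union>b\<in>V. {a} \<odot>\<^bsub>Y\<^esub> {b})"
proof -
  note b = circ_basic_coverD(1)[OF Y] and cl = circ_basic_coverD(2)[OF Y]
    and comm = circ_basic_coverD(5)[OF Y]
  have left: "P \<odot>\<^bsub>Y\<^esub> R \<approx>\<^bsub>Y\<^esub> (\<Union>a\<in>P. {a} \<odot>\<^bsub>Y\<^esub> R)" if "P \<subseteq> carr Y" "R \<subseteq> carr Y" for P R
    using circ_basic_coverD(3)[OF Y, of "(\<lambda>a. {a}) ` P" R] that
    by (auto simp: image_image intro: cov_eq_sym)
  have right: "{a} \<odot>\<^bsub>Y\<^esub> V \<approx>\<^bsub>Y\<^esub> (\<Union>b\<in>V. {a} \<odot>\<^bsub>Y\<^esub> {b})" if a: "{a} \<subseteq> carr Y" for a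
  proof -
    have "{a} \<odot>\<^bsub>Y\<^esub> V \<approx>\<^bsub>Y\<^esub> V \<odot>\<^bsub>Y\<^esub> {a}" by (rule comm[OF a V])
    also have "\<dots> \<approx>\<^bsub>Y\<^esub> (\<Union>b\<in>V. {b} \<odot>\<^bsub>Y\<^esub> {a})" by (rule left[OF V a])
    also have "\<dots> \<approx>\<^bsub>Y\<^esub> (\<Union>b\<in>V. {a} \<odot>\<^bsub>Y\<^esub> {b})"
      by (intro cov_eq_UN[OF b] conjI cl comm a) (use V in auto)
    finally show ?thesis .
  qed
  have "U \<odot>\<^bsub>Y\<^esub> V \<approx>\<^bsub>Y\<^esub> (\<Union>a\<in>U. {a} \<odot>\<^bsub>Y\<^esub> V)" by (rule left[OF U V])
  also have "\<dots> \<approx>\<^bsub>Y\<^esub> (\<Union>a\<in>U. \<Union>b\<in>V. {a} \<odot>\<^bsub>Y\<^esub> {b})"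
    by (intro cov_eq_UN[OF b] conjI UN_least cl right) (use U V in auto)
  finally show ?thesis .
qed

lemma op_coreflection_cov_eq:
  assumes Y: "circ_basic_cover Y" and U: "U \<subseteq> carr Y" and V: "V \<subseteq> carr Y"
  shows "U \<odot>\<^bsub>convergent_coreflection Y\<^esub> V \<approx>\<^bsub>Y\<^esub> U \<odot>\<^bsub>Y\<^esub> V"
  using circ_op_elementwise[OF assms] by (simp add: op_coreflection U V cov_eq_sym)

lemma coreflection_cov_eq:
  assumes Y: "cover_with_op Y" and U: "U \<subseteq> carr Y" and V: "V \<subseteq> carr Y" and UV: "U \<approx>\<^bsub>Y\<^esub> V"
  shows "U \<approx>\<^bsub>convergent_coreflection Y\<^esub> V"
proof -
  interpret convergent_generators "carr Y" "\<lambda>a. {U. (a, U) \<in> cov Y}" "\<lambda>a U. U"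
    "\<lambda>a b. {a} \<odot>\<^bsub>Y\<^esub> {b}" by (rule coreflection_generators[OF Y])
  have b: "basic_cover (convergent_coreflection Y)"
    using basic_X by (simp add: convergent_coreflection_def)
  show ?thesis
    using UV cov_coreflection[OF Y] U V
    by (auto simp: cov_eq_iff[OF cover_with_opD(1)[OF Y]] cov_eq_iff[OF b] covered_def)
qed

lemma coreflection_convergent:
  assumes Y: "cover_with_op Y"
  shows "convergent_cover (convergent_coreflection Y)" "ind_gen_convergent (convergent_coreflection Y)"
proof -
  interpret convergent_generators "carr Y" "\<lambda>a. {U. (a, U) \<in> cov Y}" "\<lambda>a U. U"
    "\<lambda>a b. {a} \<odot>\<^bsub>Y\<^esub> {b}" by (rule coreflection_generators[OF Y])
  show "convergent_cover (convergent_coreflection Y)"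
    using convergent_X by (simp add: convergent_coreflection_def)
  show "ind_gen_convergent (convergent_coreflection Y)"
    unfolding ind_gen_convergent_def carr_coreflection
  proof (intro exI conjI)
    show "convergent_coreflection Y =
      conv_ocover (carr Y) (\<lambda>a. {U. (a, U) \<in> cov Y}) (\<lambda>a U. U) (\<lambda>a b. {a} \<odot>\<^bsub>Y\<^esub> {b})"
      by (rule convergent_coreflection_def)
  qed (use axioms closed in auto)
qed

text \<open>The enlarged cover identifies more subsets, and the two operations agree up to \<open>\<approx>\<^bsub>Y\<^esub>\<close>, so the
  unit law of \<open>Y\<close> survives.\<close>

lemma circ_unit_coreflection:
  assumes Y: "circ_basic_cover Y" and E: "circ_unit Y E"
  shows "circ_unit (convergent_coreflection Y) E"
  unfolding circ_unit_def carr_coreflection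
proof (intro conjI ballI)
  have c: "cover_with_op Y" using Y by (simp add: circ_basic_cover_def)
  show E': "E \<subseteq> carr Y" using E by (simp add: circ_unit_def)
  fix a assume a: "a \<in> carr Y"
  have "{a} \<approx>\<^bsub>Y\<^esub> {a} \<odot>\<^bsub>Y\<^esub> E" using E a by (simp add: circ_unit_def)
  also have "\<dots> \<approx>\<^bsub>Y\<^esub> {a} \<odot>\<^bsub>convergent_coreflection Y\<^esub> E"
    by (rule cov_eq_sym[OF op_coreflection_cov_eq[OF Y _ E']]) (use a in simp)
  finally show "{a} \<approx>\<^bsub>convergent_coreflection Y\<^esub> {a} \<odot>\<^bsub>convergent_coreflection Y\<^esub> E"
    using a E' convergent_coverD(2)[OF coreflection_convergent(1)[OF c], of "{a}" E]
    by (intro coreflection_cov_eq[OF c]) auto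
qed

lemma unital_convergent_coreflection:
  assumes Y: "circ_basic_cover Y"
  shows "unital_convergent_cover (convergent_coreflection Y)"
proof -
  have Q: "convergent_cover (convergent_coreflection Y)"
    by (rule coreflection_convergent(1)) (use Y in \<open>simp add: circ_basic_cover_def\<close>)
  obtain E where "circ_unit Y E" using circ_basic_coverD(6)[OF Y] ..
  then have "conv_unit (convergent_coreflection Y) E"
    unfolding conv_unit_iff_circ_unit[OF Q] by (rule circ_unit_coreflection[OF Y])
  with Q show ?thesis unfolding unital_convergent_cover_def by blast
qed

text \<open>The universal property of the coreflection. The pairs \<open>(b, V)\<close> with \<open>r\<^sup>-b \<lhd> r\<^sup>-V\<close> form a
  basic cover, so it suffices to check the generators. The commutativity, associativity and
  stability axioms are carried by \<open>r\<^sup>-\<close> to instances of the corresponding laws in \<open>X\<close>; convergence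
  of \<open>X\<close> is what makes the stability axioms hold.\<close>

lemma basic_cover_map_coreflection:
  assumes X: "convergent_cover X" and Y: "circ_basic_cover Y" and r: "circ_cover_map X Y r"
  shows "basic_cover_map X (convergent_coreflection Y) r"
proof -
  note bX = convergent_coverD(1)[OF X] and bY = circ_basic_coverD(1)[OF Y]
    and rm = circ_cover_mapD(1)[OF r] and cl = circ_basic_coverD(2)[OF Y]
  note rC = preimage_in_carr[OF rm]
  have c: "cover_with_op Y" using Y by (simp add: circ_basic_cover_def)
  interpret convergent_generators "carr Y" "\<lambda>a. {U. (a, U) \<in> cov Y}" "\<lambda>a U. U"
    "\<lambda>a b. {a} \<odot>\<^bsub>Y\<^esub> {b}" by (rule coreflection_generators[OF c])
  let ?\<delta> = "\<lambda>a b. {a} \<odot>\<^bsub>Y\<^esub> {b}" and ?I = "\<lambda>a. {U. (a, U) \<in> cov Y}"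
  let ?R = "{(b, V). b \<in> carr Y \<and> V \<subseteq> carr Y \<and> r\<inverse> `` {b} \<lhd>\<^bsub>X\<^esub> r\<inverse> `` V}"
  have R: "basic_cover_on (carr Y) ?R"
    unfolding basic_cover_on_def
  proof (intro conjI allI impI)
    fix a U V assume *: "(a, U) \<in> ?R \<and> V \<subseteq> carr Y \<and> (\<forall>b\<in>U. (b, V) \<in> ?R)"
    then have "r\<inverse> `` U \<lhd>\<^bsub>X\<^esub> r\<inverse> `` V" by (subst preimage_elementwise) (simp add: covered_UN)
    with * show "(a, V) \<in> ?R" using covered_trans[OF bX _ _ rC] by auto
  qed (auto intro!: covered_subset[OF bX rC])
  have op: "r\<inverse> `` (op_of ?\<delta> U V) \<approx>\<^bsub>X\<^esub> (r\<inverse> `` U) \<odot>\<^bsub>X\<^esub> (r\<inverse> `` V)"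
    if UV: "U \<subseteq> carr Y" "V \<subseteq> carr Y" for U V
  proof -
    have "r\<inverse> `` (op_of ?\<delta> U V) \<approx>\<^bsub>X\<^esub> r\<inverse> `` (U \<odot>\<^bsub>Y\<^esub> V)"
      using circ_op_elementwise[OF Y UV] op_of_closed[OF UV] cl[OF UV]
      by (intro basic_cover_map_cov_eq[OF bX bY rm]) (auto simp: op_of_def intro: cov_eq_sym)
    also have "\<dots> \<approx>\<^bsub>X\<^esub> (r\<inverse> `` U) \<odot>\<^bsub>X\<^esub> (r\<inverse> `` V)" by (rule circ_cover_mapD(2)[OF r UV])
    finally show ?thesis .
  qed
  have opX: "P \<odot>\<^bsub>X\<^esub> P' \<approx>\<^bsub>X\<^esub> Q \<odot>\<^bsub>X\<^esub> Q'"
    if "P \<subseteq> carr X" "P' \<subseteq> carr X" "Q \<subseteq> carr X" "Q' \<subseteq> carr X" "P \<approx>\<^bsub>X\<^esub> Q" "P' \<approx>\<^bsub>X\<^esub> Q'" for P P' Q Q'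
    using that convergent_coverD(2,3)[OF X] by (simp add: cov_eq_iff[OF bX])
  \<comment> \<open>The common form of the three axioms: the subsets \<open>A\<close> and \<open>W\<close> of \<open>Y\<close> are carried to \<open>B\<close> and \<open>B'\<close>
    in \<open>X\<close>, where the law \<open>B \<lhd> B'\<close> is known.\<close>
  have le: "r\<inverse> `` {a} \<lhd>\<^bsub>X\<^esub> r\<inverse> `` W"
    if "a \<in> A" "r\<inverse> `` A \<approx>\<^bsub>X\<^esub> B" "B \<subseteq> carr X" "B \<lhd>\<^bsub>X\<^esub> B'" "r\<inverse> `` W \<approx>\<^bsub>X\<^esub> B'" "B' \<subseteq> carr X"
    for a A W B B'
  proof -
    have 1: "r\<inverse> `` {a} \<lhd>\<^bsub>X\<^esub> r\<inverse> `` A" using that(1) by (intro covered_subset[OF bX rC]) auto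
    have 2: "r\<inverse> `` A \<lhd>\<^bsub>X\<^esub> B" using that(2) by (simp add: cov_eq_iff[OF bX rC that(3)])
    have 3: "B' \<lhd>\<^bsub>X\<^esub> r\<inverse> `` W" using that(5) by (simp add: cov_eq_iff[OF bX rC that(6)])
    note tr = covered_trans[OF bX]
    show ?thesis by (rule tr[OF tr[OF tr[OF 1 2] that(4)] 3]) (intro rC that)+
  qed
  have J: "r\<inverse> `` {a} \<lhd>\<^bsub>X\<^esub> r\<inverse> `` D_sub (\<lambda>a U. U) ?\<delta> a j"
    if a: "a \<in> carr Y" and j: "j \<in> J_set (carr Y) ?I ?\<delta> a" for a j
  proof (cases j)
    case (Given U)
    with j rm show ?thesis by (auto simp: J_set_def basic_cover_map_def)
  next
    case (Comm b c)
    with j have bc: "{b} \<subseteq> carr Y" "{c} \<subseteq> carr Y" "a \<in> {b} \<odot>\<^bsub>Y\<^esub> {c}" by (auto simp: J_set_def)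
    have "(r\<inverse> `` {b}) \<odot>\<^bsub>X\<^esub> (r\<inverse> `` {c}) \<lhd>\<^bsub>X\<^esub> (r\<inverse> `` {c}) \<odot>\<^bsub>X\<^esub> (r\<inverse> `` {b})"
      using convergent_coverD(4)[OF X rC rC]
      by (simp add: cov_eq_iff[OF bX] convergent_coverD(2)[OF X rC rC])
    then have "r\<inverse> `` {a} \<lhd>\<^bsub>X\<^esub> r\<inverse> `` ({c} \<odot>\<^bsub>Y\<^esub> {b})"
      by (intro le[OF bc(3) circ_cover_mapD(2)[OF r bc(1,2)] _ _ circ_cover_mapD(2)[OF r bc(2,1)]]
          convergent_coverD(2)[OF X] rC)
    with Comm show ?thesis by simp
  next
    case (Assoc b c d)
    with j have bcd: "{b} \<subseteq> carr Y" "{c} \<subseteq> carr Y" "{d} \<subseteq> carr Y"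
      and a: "a \<in> op_of ?\<delta> ({b} \<odot>\<^bsub>Y\<^esub> {c}) {d}" by (auto simp: J_set_def)
    note clX = convergent_coverD(2)[OF X] rC
    let ?b = "r\<inverse> `` {b}" and ?c = "r\<inverse> `` {c}" and ?d = "r\<inverse> `` {d}"
    have "r\<inverse> `` op_of ?\<delta> ({b} \<odot>\<^bsub>Y\<^esub> {c}) {d} \<approx>\<^bsub>X\<^esub> (r\<inverse> `` ({b} \<odot>\<^bsub>Y\<^esub> {c})) \<odot>\<^bsub>X\<^esub> ?d"
      by (intro op cl bcd)
    also have "\<dots> \<approx>\<^bsub>X\<^esub> (?b \<odot>\<^bsub>X\<^esub> ?c) \<odot>\<^bsub>X\<^esub> ?d"
      by (intro opX clX circ_cover_mapD(2)[OF r] bcd cov_eq_refl)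
    finally have 1: "r\<inverse> `` op_of ?\<delta> ({b} \<odot>\<^bsub>Y\<^esub> {c}) {d} \<approx>\<^bsub>X\<^esub> (?b \<odot>\<^bsub>X\<^esub> ?c) \<odot>\<^bsub>X\<^esub> ?d" .
    have "r\<inverse> `` op_of ?\<delta> {b} ({c} \<odot>\<^bsub>Y\<^esub> {d}) \<approx>\<^bsub>X\<^esub> ?b \<odot>\<^bsub>X\<^esub> (r\<inverse> `` ({c} \<odot>\<^bsub>Y\<^esub> {d}))"
      by (intro op cl bcd)
    also have "\<dots> \<approx>\<^bsub>X\<^esub> ?b \<odot>\<^bsub>X\<^esub> (?c \<odot>\<^bsub>X\<^esub> ?d)"
      by (intro opX clX circ_cover_mapD(2)[OF r] bcd cov_eq_refl)
    finally have 2: "r\<inverse> `` op_of ?\<delta> {b} ({c} \<odot>\<^bsub>Y\<^esub> {d}) \<approx>\<^bsub>X\<^esub> ?b \<odot>\<^bsub>X\<^esub> (?c \<odot>\<^bsub>X\<^esub> ?d)" .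
    have "(?b \<odot>\<^bsub>X\<^esub> ?c) \<odot>\<^bsub>X\<^esub> ?d \<lhd>\<^bsub>X\<^esub> ?b \<odot>\<^bsub>X\<^esub> (?c \<odot>\<^bsub>X\<^esub> ?d)"
      using convergent_coverD(5)[OF X rC rC rC]
      by (simp add: cov_eq_iff[OF bX] clX)
    then have "r\<inverse> `` {a} \<lhd>\<^bsub>X\<^esub> r\<inverse> `` op_of ?\<delta> {b} ({c} \<odot>\<^bsub>Y\<^esub> {d})"
      by (intro le[OF a 1 _ _ 2] clX)
    with Assoc show ?thesis by simp
  qed
  have stab: "r\<inverse> `` {a} \<lhd>\<^bsub>X\<^esub> r\<inverse> `` op_of ?\<delta> (D_sub (\<lambda>a U. U) ?\<delta> b j) {c}"
    if bc: "b \<in> carr Y" "c \<in> carr Y" and a: "a \<in> ?\<delta> b c" and j: "j \<in> J_set (carr Y) ?I ?\<delta> b" for a b c j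
  proof -
    have D: "D_sub (\<lambda>a U. U) ?\<delta> b j \<subseteq> carr Y" using axiom_set_D bc j by (auto simp: axiom_set_def)
    have s: "{b} \<subseteq> carr Y" "{c} \<subseteq> carr Y" using bc by auto
    show ?thesis
      by (rule le[OF a circ_cover_mapD(2)[OF r s] _ _ op[OF D s(2)]])
        (intro convergent_coverD(2,3)[OF X] rC J[OF bc(1) j] covered_subset[OF bX rC] order_refl)+
  qed
  have "gen_cover (carr Y) (stab_set (carr Y) (J_set (carr Y) ?I ?\<delta>) ?\<delta>)
      (stab_sub (D_sub (\<lambda>a U. U) ?\<delta>) ?\<delta>) \<subseteq> ?R"
  proof (rule gen_cover_least[OF R])
    fix a k assume a: "a \<in> carr Y" and k: "k \<in> stab_set (carr Y) (J_set (carr Y) ?I ?\<delta>) ?\<delta> a"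
    have "stab_sub (D_sub (\<lambda>a U. U) ?\<delta>) ?\<delta> a k \<subseteq> carr Y"
      using axiom_set_stab a k by (auto simp: axiom_set_def)
    moreover have "r\<inverse> `` {a} \<lhd>\<^bsub>X\<^esub> r\<inverse> `` stab_sub (D_sub (\<lambda>a U. U) ?\<delta>) ?\<delta> a k"
    proof (cases k)
      case (Plain j)
      with k J[OF a] show ?thesis by (auto simp: stab_set_def)
    next
      case (Stab b c j)
      with k stab[of b c a j] show ?thesis by (auto simp: stab_set_def)
    qed
    ultimately show "(a, stab_sub (D_sub (\<lambda>a U. U) ?\<delta>) ?\<delta> a k) \<in> ?R" using a by simp
  qed
  then show ?thesis
    using rm by (auto simp: basic_cover_map_def convergent_coreflection_def conv_ocover_def)
qed

text \<open>The operations of \<open>Y\<close> and of its coreflection agree up to \<open>\<approx>\<^bsub>Y\<^esub>\<close>, and every unit of \<open>Y\<close> is one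
  of the coreflection; so the two conditions on operation and unit coincide once \<open>r\<close> is known to be
  a basic cover map into both.\<close>

lemma circ_cover_map_coreflection_iff:
  assumes X: "convergent_cover X" and Y: "circ_basic_cover Y"
  shows "circ_cover_map X (convergent_coreflection Y) r \<longleftrightarrow> circ_cover_map X Y r"
proof -
  let ?Q = "convergent_coreflection Y"
  have c: "cover_with_op Y" using Y by (simp add: circ_basic_cover_def)
  note cQ = coreflection_convergent[OF c]
  note bX = convergent_coverD(1)[OF X] and bY = circ_basic_coverD(1)[OF Y]
    and bQ = convergent_coverD(1)[OF cQ(1)]
  have Q: "circ_basic_cover ?Q"
    by (rule unital_convergent_circ_basic[OF unital_convergent_coreflection[OF Y] cQ(2)])
  have unit: "r\<inverse> `` E \<approx>\<^bsub>X\<^esub> r\<inverse> `` E'"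
    if "basic_cover_map X ?Q r" "circ_unit ?Q E" "circ_unit ?Q E'" for E E'
    using basic_cover_map_cov_eq[OF bX bQ that(1)] circ_unit_unique[OF Q that(2,3)]
      that(2,3)[THEN circ_unit_in_carr] by blast
  have op: "r\<inverse> `` (U \<odot>\<^bsub>?Q\<^esub> V) \<approx>\<^bsub>X\<^esub> r\<inverse> `` (U \<odot>\<^bsub>Y\<^esub> V)"
    if r: "basic_cover_map X Y r" and UV: "U \<subseteq> carr Y" "V \<subseteq> carr Y" for U V
    using op_coreflection_cov_eq[OF Y UV] circ_basic_coverD(2)[OF Y UV]
      convergent_coverD(2)[OF cQ(1), of U V] UV
    by (intro basic_cover_map_cov_eq[OF bX bY r]) auto
  show ?thesis
  proof
    assume r: "circ_cover_map X ?Q r"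
    have rm: "basic_cover_map X Y r"
      using basic_cover_map_coarser[OF circ_cover_mapD(1)[OF r] _ cov_coreflection[OF c]] by simp
    show "circ_cover_map X Y r"
      unfolding circ_cover_map_def
      using rm cov_eq_trans[OF cov_eq_sym[OF op[OF rm]] circ_cover_mapD(2)[OF r]]
        circ_cover_mapD(3)[OF r _ circ_unit_coreflection[OF Y]] by simp
  next
    assume r: "circ_cover_map X Y r"
    have rm: "basic_cover_map X ?Q r" by (rule basic_cover_map_coreflection[OF X Y r])
    obtain E0 where E0: "circ_unit Y E0" using circ_basic_coverD(6)[OF Y] by blast
    show "circ_cover_map X ?Q r"
      unfolding circ_cover_map_def
      using rm cov_eq_trans[OF op[OF circ_cover_mapD(1)[OF r]] circ_cover_mapD(2)[OF r]]
        cov_eq_trans[OF unit[OF rm _ circ_unit_coreflection[OF Y E0]] circ_cover_mapD(3)[OF r _ E0]]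
      by simp
  qed
qed

text \<open>Both covers have the same points, hence \<open>map_eq\<close> is the same relation for both. It remains to
  see that a relation equal to \<open>r\<close> which is a basic cover map into \<open>Y\<close> is also one into the
  coreflection; it inherits this from \<open>r\<close>.\<close>

lemma map_class_coreflection:
  assumes X: "convergent_cover X" and Y: "circ_basic_cover Y" and r: "circ_cover_map X Y r"
  shows "map_class X (convergent_coreflection Y) r = map_class X Y r"
proof -
  let ?Q = "convergent_coreflection Y"
  have c: "cover_with_op Y" using Y by (simp add: circ_basic_cover_def)
  note bX = convergent_coverD(1)[OF X]
    and bQ = convergent_coverD(1)[OF coreflection_convergent(1)[OF c]]
  have eq: "map_eq X ?Q r t \<longleftrightarrow> map_eq X Y r t" for t by (simp add: map_eq_def)
  have "basic_cover_map X ?Q t \<longleftrightarrow> basic_cover_map X Y t" if "map_eq X Y r t" for t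
  proof
    show "basic_cover_map X Y t" if "basic_cover_map X ?Q t"
      using basic_cover_map_coarser[OF that _ cov_coreflection[OF c]] by simp
    assume "basic_cover_map X Y t"
    then have "t \<subseteq> carr X \<times> carr ?Q" by (simp add: basic_cover_map_def)
    then show "basic_cover_map X ?Q t"
      using basic_cover_map_transfer[OF bX bQ basic_cover_map_coreflection[OF X Y r]] eq that by blast
  qed
  then show ?thesis by (auto simp: map_class_def eq)
qed

text \<open>The identity relation is a map \<open>X \<rightarrow> X\<close>, hence by the universal property a map from \<open>X\<close> to its
  coreflection, which says that the cover has not grown. The operations agree strictly because
  that of \<open>X\<close> is generated by its values on points.\<close>

lemma coreflection_fixes_convergent:
  assumes X: "convergent_cover X" and g: "ind_gen_convergent X" and c: "circ_basic_cover X"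
  shows "convergent_coreflection X = X"
proof -
  let ?Q = "convergent_coreflection X"
  have w: "cover_with_op X" using c by (simp add: circ_basic_cover_def)
  have "cov ?Q \<subseteq> cov X"
  proof
    fix p assume p: "p \<in> cov ?Q"
    obtain a U where pe: "p = (a, U)" by (cases p)
    have "basic_cover_map X ?Q (Id_on (carr X))"
      by (rule basic_cover_map_coreflection[OF X c circ_cover_map_Id[OF c]])
    with p pe have "(Id_on (carr X))\<inverse> `` {a} \<lhd>\<^bsub>X\<^esub> (Id_on (carr X))\<inverse> `` U"
      by (simp add: basic_cover_map_def)
    moreover have "a \<in> carr X \<and> U \<subseteq> carr X"
      using cov_in_carr[OF convergent_coverD(1)[OF coreflection_convergent(1)[OF w]]] p pe by simp
    then have "(Id_on (carr X))\<inverse> `` {a} = {a}" "(Id_on (carr X))\<inverse> `` U = U" by auto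
    ultimately show "p \<in> cov X" by (simp add: covered_def pe)
  qed
  then have "cov ?Q = cov X" using cov_coreflection[OF w] by blast
  moreover have "oper ?Q = oper X"
  proof (rule PiE_ext)
    show "oper X \<in> Pow (carr X) \<times> Pow (carr X) \<rightarrow>\<^sub>E Pow (carr X)"
      using w by (simp add: cover_with_op_def)
    show "oper ?Q \<in> Pow (carr X) \<times> Pow (carr X) \<rightarrow>\<^sub>E Pow (carr X)"
      using coreflection_convergent(1)[OF w] by (simp add: convergent_cover_def cover_with_op_def)
    fix p assume "p \<in> Pow (carr X) \<times> Pow (carr X)"
    then show "oper ?Q p = oper X p"
      by (cases p) (simp add: op_coreflection ind_gen_convergent_op[OF g])
  qed
  ultimately show ?thesis by (intro ocover.equality) simp_all
qed


section \<open>The adjunction\<close>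

lemma obj_BCov_circ_i: "Y \<in> obj BCov_circ_i \<longleftrightarrow> circ_basic_cover Y"
  using basic_cover_generates_itself[of Y] circ_basic_coverD(1)[of Y]
  unfolding BCov_circ_i_def ind_gen_basic_def by (auto intro: sym)

lemma obj_uCBCov_i:
  "X \<in> obj uCBCov_i \<longleftrightarrow> unital_convergent_cover X \<and> ind_gen_convergent X"
  by (simp add: uCBCov_i_def)

lemma obj_uCBCov_iD:
  assumes "X \<in> obj uCBCov_i"
  shows "convergent_cover X" "circ_basic_cover X"
  using assms unital_convergent_circ_basic by (auto simp: obj_uCBCov_i unital_convergent_cover_def)

lemma hom_BCov_circ_i: "hom BCov_circ_i X Y = map_class X Y ` {r. circ_cover_map X Y r}"
  by (simp add: BCov_circ_i_def)

theorem proposition7p4: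
  shows "\<exists>Q :: ('a ocover, 'a rel set, 'a ocover, 'a rel set) func.
    is_right_adjoint (uCBCov_i :: ('a ocover, 'a rel set) cat) BCov_circ_i forgetful Q \<and>
    surj_on_objects BCov_circ_i uCBCov_i Q"
proof -
  let ?C = "uCBCov_i :: ('a ocover, 'a rel set) cat"
  let ?D = "BCov_circ_i :: ('a ocover, 'a rel set) cat"
  let ?q = "convergent_coreflection :: 'a ocover \<Rightarrow> 'a ocover"
  let ?e = "\<lambda>Y. map_class (?q Y) Y (Id_on (carr Y))"
  let ?Q = "\<lparr>fobj = ?q, fmap = \<lambda>Y Y' f. cat_comp ?D (?q Y) Y Y' f (?e Y)\<rparr>"
  have q: "?q Y \<in> obj ?C" if "Y \<in> obj ?D" for Y
    using that unital_convergent_coreflection[of Y] coreflection_convergent(2)[of Y]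
    by (auto simp: obj_uCBCov_i obj_BCov_circ_i circ_basic_cover_def)
  have e: "circ_cover_map (?q Y) Y (Id_on (carr Y))" if "Y \<in> obj ?D" for Y
    using circ_cover_map_Id[OF obj_uCBCov_iD(2)[OF q[OF that]]]
      circ_cover_map_coreflection_iff[OF obj_uCBCov_iD(1)[OF q[OF that]]] that
    by (simp add: obj_BCov_circ_i)
  have "is_right_adjoint ?C ?D \<lparr>fobj = \<lambda>X. X, fmap = \<lambda>X Y f. f\<rparr> ?Q"
  proof (rule coreflection_right_adjoint)
    show "is_category ?D" by (rule is_category_BCov_circ_i)
    show "obj ?C \<subseteq> obj ?D" using obj_uCBCov_iD(2) by (auto simp: obj_BCov_circ_i)
    show "hom ?C X Y = hom ?D X Y" if "X \<in> obj ?C" "Y \<in> obj ?C" for X Y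
    proof -
      have "unital_convergent_cover_map X Y = circ_cover_map X Y"
        using that unital_convergent_cover_map_iff[of X Y] by (simp add: obj_uCBCov_i fun_eq_iff)
      then show ?thesis by (simp add: uCBCov_i_def BCov_circ_i_def)
    qed
    show "cat_comp ?C = cat_comp ?D" "ident ?C = ident ?D"
      by (simp_all add: uCBCov_i_def BCov_circ_i_def)
    show "?q Y \<in> obj ?C" if "Y \<in> obj ?D" for Y by (rule q[OF that])
    show "?e Y \<in> hom ?D (?q Y) Y" if "Y \<in> obj ?D" for Y
      using e[OF that] by (auto simp: hom_BCov_circ_i)
    fix X Y assume X: "X \<in> obj ?C" and Y: "Y \<in> obj ?D"
    have Y': "circ_basic_cover Y" using Y by (simp add: obj_BCov_circ_i)
    note iff = circ_cover_map_coreflection_iff[OF obj_uCBCov_iD(1)[OF X] Y']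
      and cls = map_class_coreflection[OF obj_uCBCov_iD(1)[OF X] Y']
    show hom_eq: "hom ?D X (?q Y) = hom ?D X Y"
      using iff cls by (auto simp: hom_BCov_circ_i)
    fix f assume "f \<in> hom ?D X (?q Y)"
    then obtain r where r: "circ_cover_map X (?q Y) r" and f: "f = map_class X (?q Y) r"
      by (auto simp: hom_BCov_circ_i)
    have rY: "circ_cover_map X Y r" using r iff by simp
    have "cat_comp ?D X (?q Y) Y (?e Y) f = comp_class X (?q Y) Y (?e Y) f"
      by (simp add: BCov_circ_i_def)
    also have "\<dots> = map_class X Y (r O Id_on (carr Y))"
      unfolding f using obj_uCBCov_iD(2)[OF X] obj_uCBCov_iD(2)[OF q[OF Y]] r e[OF Y]
      by (intro comp_class_map_class circ_basic_coverD(1) circ_cover_mapD(1))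
    also have "r O Id_on (carr Y) = r"
      using circ_cover_mapD(1)[OF rY] by (auto simp: basic_cover_map_def)
    finally show "cat_comp ?D X (?q Y) Y (?e Y) f = f" using cls[OF rY] f by simp
  qed
  moreover have "surj_on_objects ?D ?C ?Q"
    unfolding surj_on_objects_def
  proof
    show "fobj ?Q ` obj ?D \<subseteq> obj ?C" using q by auto
    show "obj ?C \<subseteq> fobj ?Q ` obj ?D"
    proof
      fix X assume X: "X \<in> obj ?C"
      have "?q X = X"
        using coreflection_fixes_convergent[of X] obj_uCBCov_iD[OF X] X by (simp add: obj_uCBCov_i)
      with obj_uCBCov_iD(2)[OF X] show "X \<in> fobj ?Q ` obj ?D"
        by (intro image_eqI[of _ _ X]) (auto simp: obj_BCov_circ_i)
    qed
  qed
  ultimately show ?thesis unfolding forgetful_def by blast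
qed

end
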